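(* Let $\sigma\in\mathrm{Aut}(G)$. For each $s\in\widehat{K}$ let $s'\in\widehat{K}$ be the point with $\sigma(G(s))=G(s')$. Then the rule $Gs\mapsto Gs'$ gives a well-defined map $\sigma^*:\mathrm{Cusp}(G)\to\mathrm{Cusp}(G)$, and $\sigma^*$ is a permutation of $\mathrm{Cusp}(G)$. (In particular $\mathrm{Aut}(G)$ acts on $\mathrm{Cusp}(G)$.)
   Context: Let $\mathbb{F}_q$ be a finite field, $K$ an algebraic function field in one variable with constant field $\mathbb{F}_q$, $\infty$ a fixed place of $K$, and $A$ the ring of elements of $K$ integral at every place other than $\infty$. Let $G=GL_2(A)$ act on $\widehat{K}=\mathbb{P}^1(K)=K\cup\{\infty\}$ by Möbius transformations. For $s\in\widehat{K}$, $G(s)$ is the stabilizer of $s$ in $G$; for every automorphism $\sigma$ of $G$ and every $s$ there is a unique $s'\in\widehat{K}$ with $\sigma(G(s))=G(s')$. The set of cusps is $\mathrm{Cusp}(G)=G\backslash\widehat{K}$, the set of $G$-orbits $Gs$ on $\widehat{K}$ (a finite set in bijection with the ideal class group of $A$). *)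

theory Defs
  imports "HOL-Algebra.Algebra" "HOL-Algebra.Algebraic_Closure_Type" "HOL-Analysis.Determinants"
begin

unbundle no fps_syntax

text \<open>
  The function field is a type \<open>'k :: field\<close>; its subfields and subrings are sets. To use the
  subfields, ideals, algebraic elements and degrees of HOL-Algebra, the type is viewed as a ring
  record.
\<close>

abbreviation KK :: "'k::field ring" where
  "KK \<equiv> ring_of_type_algebra"

text \<open>
  The type \<open>'k\<close> is an algebraic function field in one variable over \<open>F\<close>: a finite extension of
  \<open>F(x)\<close> for some \<open>x\<close> transcendental over \<open>F\<close>. Moreover \<open>F\<close> is the full constant field, that is,
  algebraically closed in \<open>'k\<close>.
\<close>

definition function_field_with_constants :: "'k::field set \<Rightarrow> bool" where
  "function_field_with_constants F \<longleftrightarrow>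
     subfield F KK \<and>
     (\<exists>x. ring.transcendental KK F x \<and>
          ring.finite_dimension KK (generate_field KK (insert x F)) UNIV) \<and>
     {x. ring.algebraic KK F x} = F"

text \<open>
  Valuation rings and places as in Stichtenoth, \<^emph>\<open>Algebraic Function Fields and Codes\<close>, Section
  1.1: a place is the maximal ideal of a valuation ring, and it determines this ring.
\<close>

definition valuation_rings :: "'k::field set \<Rightarrow> 'k set set" where
  "valuation_rings F =
     {R. subring R KK \<and> F \<subset> R \<and> R \<subset> UNIV \<and> (\<forall>z. z \<noteq> 0 \<longrightarrow> z \<in> R \<or> inverse z \<in> R)}"

definition places :: "'k::field set \<Rightarrow> 'k set set" where
  "places F = {P. \<exists>R\<in>valuation_rings F. maximalideal P (KK\<lparr>carrier := R\<rparr>)}"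

definition integral_at :: "'k::field set \<Rightarrow> 'k set \<Rightarrow> 'k \<Rightarrow> bool" where
  "integral_at F P z \<longleftrightarrow>
     (\<exists>R\<in>valuation_rings F. maximalideal P (KK\<lparr>carrier := R\<rparr>) \<and> z \<in> R)"

definition integers_away_from :: "'k::field set \<Rightarrow> 'k set \<Rightarrow> 'k set" where
  "integers_away_from F Pinf = {z. \<forall>P\<in>places F - {Pinf}. integral_at F P z}"

definition M2 :: "'k::field set \<Rightarrow> ('k^2^2) monoid" where
  "M2 A = \<lparr>carrier = {M. \<forall>i j. M $ i $ j \<in> A}, monoid.mult = (**), one = mat 1\<rparr>"

definition GL2 :: "'k::field set \<Rightarrow> ('k^2^2) monoid" where
  "GL2 A = units_of (M2 A)"

text \<open>The projective line over \<open>'k\<close> is \<open>'k option\<close>, with \<^term>\<open>None\<close> as the point at infinity.\<close>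

fun moebius :: "'k::field^2^2 \<Rightarrow> 'k option \<Rightarrow> 'k option" where
  "moebius M None =
     (if M $ 2 $ 1 = 0 then None else Some (M $ 1 $ 1 / M $ 2 $ 1))"
| "moebius M (Some z) =
     (if M $ 2 $ 1 * z + M $ 2 $ 2 = 0 then None
      else Some ((M $ 1 $ 1 * z + M $ 1 $ 2) / (M $ 2 $ 1 * z + M $ 2 $ 2)))"

definition stab :: "'k::field set \<Rightarrow> 'k option \<Rightarrow> ('k^2^2) set" where
  "stab A s = stabilizer (GL2 A) moebius s"

definition cusp :: "'k::field set \<Rightarrow> 'k option \<Rightarrow> 'k option set" where
  "cusp A s = orbit (GL2 A) moebius s"

definition cusps :: "'k::field set \<Rightarrow> 'k option set set" where
  "cusps A = orbits (GL2 A) UNIV moebius"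

text \<open>
  The induced map on cusps, extensional on \<^term>\<open>cusps A\<close> as \<^term>\<open>BijGroup\<close> requires. The
  description is meaningful only once the rule taking the orbit of \<open>s\<close> to the orbit of \<open>s'\<close> is
  known to be well defined.
\<close>

definition cusp_map ::
  "'k::field set \<Rightarrow> ('k^2^2 \<Rightarrow> 'k^2^2) \<Rightarrow> 'k option set \<Rightarrow> 'k option set" where
  "cusp_map A \<sigma> =
     (\<lambda>C\<in>cusps A. THE C'. \<exists>s s'. C = cusp A s \<and> \<sigma> ` stab A s = stab A s' \<and> C' = cusp A s')"

end

theory Submission
  imports Defs
begin

text \<open>
  A nontrivial unipotent matrix \<open>u\<close> of \<open>G = GL\<^sub>2(A)\<close> fixes exactly one point \<open>s\<close> of the projective line, and
  two unipotent matrices with the same fixed point commute. Hence \<open>G(s)\<close> consists of the \<open>g\<close> in \<open>G\<close>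
  for which \<open>g u g\<inverse>\<close> commutes with \<open>u\<close>. In characteristic \<open>p\<close> the nontrivial unipotent matrices are
  the elements of order \<open>p\<close>, so an automorphism of \<open>G\<close> permutes them and therefore the stabilizers \<open>G(s)\<close>;
  it respects orbits because \<open>G(gs) = g G(s) g\<inverse>\<close>.

  That every \<open>G(s)\<close> contains such a \<open>u\<close> needs \<open>K = Frac A\<close>, that is, a nonconstant function whose only pole
  is \<open>\<infinity>\<close>. It is found by counting over the finite field, as in the proof of Riemann's inequality.
\<close>

section \<open>Unipotent matrices and stabilizers of cusps\<close>

text \<open>The commutation criterion for \<open>stab A s\<close> involves only group operations and
  one unipotent element, so any automorphism transports it once unipotents are recognized by their
  order. The condition \<open>K = Frac A\<close> serves to give a point coordinates
  \<open>x\<close>, \<open>y\<close> in \<open>A\<close>: then 1 plus the square-zero matrix (x,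
  y)^T (y, -x) is a unipotent over \<open>A\<close> fixing it.

  For the fraction field the obstacle is that a place is given as an abstract valuation ring,
  without a valuation with values in the integers. Finiteness of \<open>F\<close> takes over the
  role of orders of vanishing. For \<open>w\<close> nonzero in the maximal ideal at infinity, the
  functions integral at all zeros of \<open>w\<close> form a ring \<open>S\<close> with S / w^m S
  finite. This makes powers repeat modulo \<open>w\<close>, leaves only finitely many places above
  \<open>w\<close>, separates them, and gives the bound against which functions are counted.

  A nonconstant \<open>t\<close> in \<open>A\<close> is enough: every \<open>z\<close> is algebraic
  over F(t), and the leading coefficient of a relation is a denominator d(t) in \<open>A\<close>
  with d(t) z in \<open>A\<close>.\<close>

no_notation fps_nth (infixl \<open>$\<close> 75)

lemma mat2_eq_iff:
  "M = N \<longleftrightarrow> M $ 1 $ 1 = N $ 1 $ 1 \<and> M $ 1 $ 2 = N $ 1 $ 2 \<and> M $ 2 $ 1 = N $ 2 $ 1 \<and> M $ 2 $ 2 = N $ 2 $ 2"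
  for M N :: "'k::zero^2^2"
  by (auto simp: vec_eq_iff forall_2)

lemma mat2_mult_nth: "(M ** N) $ i $ j = M $ i $ 1 * N $ 1 $ j + M $ i $ 2 * N $ 2 $ j"
  for M N :: "'k::semiring_1^2^2"
  by (simp add: matrix_matrix_mult_def sum_2)

lemma mat2_one_nth [simp]:
  "(mat 1 :: 'k::semiring_1^2^2) $ 1 $ 1 = 1" "(mat 1 :: 'k::semiring_1^2^2) $ 1 $ 2 = 0"
  "(mat 1 :: 'k::semiring_1^2^2) $ 2 $ 1 = 0" "(mat 1 :: 'k::semiring_1^2^2) $ 2 $ 2 = 1"
  by (simp_all add: mat_def)

lemma moebius_mult:
  assumes "det N \<noteq> 0"
  shows "moebius (M ** N) s = moebius M (moebius N s)"
proof -
  \<comment> \<open>\<open>m x y\<close> is the image under \<open>M\<close> of the point with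
    homogeneous coordinates x, y; the determinant of \<open>N\<close> keeps both coordinates from
    vanishing.\<close>
  define m where "m = (\<lambda>x y. if M $ 2 $ 1 * x + M $ 2 $ 2 * y = 0 then None
    else Some ((M $ 1 $ 1 * x + M $ 1 $ 2 * y) / (M $ 2 $ 1 * x + M $ 2 $ 2 * y)))"
  have homog: "moebius M (Some (x / y)) = m x y" if "y \<noteq> 0" for x y
  proof -
    have *: "a * (x / y) + b = (a * x + b * y) / y" for a b
      using that by (simp add: add_divide_distrib)
    show ?thesis unfolding m_def moebius.simps * using that by simp
  qed
  have None: "moebius M None = m x 0" if "x \<noteq> 0" for x
    using that by (simp add: m_def)
  have *: "(if y = 0 then moebius M None else moebius M (Some (x / y))) = m x y"
    if "x \<noteq> 0 \<or> y \<noteq> 0" for x y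
    using that homog None by auto
  show ?thesis
  proof (cases s)
    case None
    have "N $ 1 $ 1 \<noteq> 0 \<or> N $ 2 $ 1 \<noteq> 0"
      using assms by (auto simp: det_2)
    from *[OF this] have "moebius M (moebius N None) = m (N $ 1 $ 1) (N $ 2 $ 1)"
      by (simp only: moebius.simps(1) if_distrib[of "moebius M"])
    then show ?thesis
      by (simp add: None m_def mat2_mult_nth del: moebius.simps(2))
  next
    case (Some z)
    define x y where "x = N $ 1 $ 1 * z + N $ 1 $ 2" and "y = N $ 2 $ 1 * z + N $ 2 $ 2"
    have "N $ 1 $ 1 * y - N $ 2 $ 1 * x = det N"
      by (simp add: x_def y_def det_2 algebra_simps)
    then have "x \<noteq> 0 \<or> y \<noteq> 0"
      using assms by auto
    from *[OF this] have "moebius M (moebius N s) = m x y"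
      by (auto simp: Some x_def y_def)
    also have "m x y = moebius (M ** N) s"
      by (simp add: Some m_def x_def y_def mat2_mult_nth algebra_simps)
    finally show ?thesis ..
  qed
qed

lemma moebius_one [simp]: "moebius (mat 1) s = s"
  by (cases s) auto

text \<open>These are the nonidentity matrices with characteristic polynomial (X - 1)^2, hence with
  (u - 1)^2 = 0.\<close>

definition unipotent :: "'k::field^2^2 \<Rightarrow> bool" where
  "unipotent u \<longleftrightarrow> u \<noteq> mat 1 \<and> u $ 1 $ 1 + u $ 2 $ 2 = 2 \<and> det u = 1"

lemma unipotent_entries:
  assumes "unipotent u"
  obtains a b c where "u $ 1 $ 1 = 1 + a" "u $ 1 $ 2 = b" "u $ 2 $ 1 = c" "u $ 2 $ 2 = 1 - a"
    "a * a + b * c = 0" "a \<noteq> 0 \<or> b \<noteq> 0 \<or> c \<noteq> 0"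
proof -
  let ?a = "u $ 1 $ 1 - 1"
  have tr: "u $ 1 $ 1 + u $ 2 $ 2 = 2" and det: "det u = 1"
    using assms by (simp_all add: unipotent_def)
  have "u $ 2 $ 2 = 2 - u $ 1 $ 1"
    using tr by (simp add: eq_diff_eq add.commute)
  then have *: "u $ 2 $ 2 = 1 - ?a" by simp
  have "?a * ?a + u $ 1 $ 2 * u $ 2 $ 1 = 0"
    using det unfolding det_2 * by Groebner_Basis.algebra
  moreover have "?a \<noteq> 0 \<or> u $ 1 $ 2 \<noteq> 0 \<or> u $ 2 $ 1 \<noteq> 0"
  proof (rule ccontr)
    assume "\<not> ?thesis"
    then have "u = mat 1" using * by (simp add: mat2_eq_iff)
    then show False using assms by (simp add: unipotent_def)
  qed
  ultimately show thesis using that[of ?a] * by simp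
qed

text \<open>The fixed points are the lines in the kernel of the nilpotent matrix u - 1, which is
  one-dimensional. In coordinates, for nonzero \<open>c\<close> the fixed point equation becomes (c
  z - a)^2 = 0.\<close>

lemma unipotent_fixpoint:
  assumes "unipotent u"
  shows "moebius u s = s \<longleftrightarrow> s = (if u $ 2 $ 1 = 0 then None else Some ((u $ 1 $ 1 - 1) / u $ 2 $ 1))"
proof -
  obtain a b c where u: "u $ 1 $ 1 = 1 + a" "u $ 1 $ 2 = b" "u $ 2 $ 1 = c" "u $ 2 $ 2 = 1 - a"
    and det: "a * a + b * c = 0" and nz: "a \<noteq> 0 \<or> b \<noteq> 0 \<or> c \<noteq> 0"
    using unipotent_entries[OF assms] by blast
  show ?thesis
  proof (cases "c = 0")
    case True
    then show ?thesis using u det nz by (cases s) auto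
  next
    case False
    show ?thesis
    proof (cases s)
      case None
      then show ?thesis using u False by simp
    next
      case (Some z)
      have fix_iff: "moebius u (Some z) = Some z \<longleftrightarrow>
          c * z + (1 - a) \<noteq> 0 \<and> (1 + a) * z + b = z * (c * z + (1 - a))"
        by (simp add: u nonzero_divide_eq_eq)
      have "(1 + a) * z + b = z * (c * z + (1 - a)) \<longleftrightarrow> c * ((1 + a) * z + b) = c * (z * (c * z + (1 - a)))"
        using False by simp
      also have "\<dots> \<longleftrightarrow> (c * z - a) * (c * z - a) = 0"
        using det by Groebner_Basis.algebra
      also have "\<dots> \<longleftrightarrow> c * z = a" by simp
      finally have "moebius u (Some z) = Some z \<longleftrightarrow> c * z = a"
        unfolding fix_iff by auto
      also have "\<dots> \<longleftrightarrow> z = a / c" using False by (auto simp: field_simps)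
      finally show ?thesis using Some False u by simp
    qed
  qed
qed

text \<open>A common finite fixed point z makes both matrices u - 1 and v - 1 multiples of the one
  with rows (z, -z^2) and (1, -z); for the point at infinity both are strictly upper
  triangular.\<close>

lemma unipotents_commute:
  assumes "unipotent u" "unipotent v" "moebius u s = s" "moebius v s = s"
  shows "u ** v = v ** u"
proof -
  obtain a b c where u: "u $ 1 $ 1 = 1 + a" "u $ 1 $ 2 = b" "u $ 2 $ 1 = c" "u $ 2 $ 2 = 1 - a"
    and det: "a * a + b * c = 0"
    using unipotent_entries[OF assms(1)] by metis
  obtain a' b' c' where v: "v $ 1 $ 1 = 1 + a'" "v $ 1 $ 2 = b'" "v $ 2 $ 1 = c'" "v $ 2 $ 2 = 1 - a'"
    and det': "a' * a' + b' * c' = 0"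
    using unipotent_entries[OF assms(2)] by metis
  have "s = (if c = 0 then None else Some (a / c))"
    using unipotent_fixpoint[THEN iffD1, OF assms(1,3)] unfolding u by simp
  moreover have "s = (if c' = 0 then None else Some (a' / c'))"
    using unipotent_fixpoint[THEN iffD1, OF assms(2,4)] unfolding v by simp
  ultimately have *: "s = (if c = 0 then None else Some (a / c))" "s = (if c' = 0 then None else Some (a' / c'))"
    by blast+
  show ?thesis
  proof (cases s)
    case None
    then have "c = 0" "c' = 0" "a = 0" "a' = 0"
      using * det det' by (auto split: if_splits)
    then show ?thesis by (simp add: mat2_eq_iff mat2_mult_nth u v)
  next
    case (Some z)
    then have c: "c \<noteq> 0" "c' \<noteq> 0" and "z = a / c" "z = a' / c'"
      using * by (auto split: if_splits)
    then have a: "a = z * c" "a' = z * c'" by (metis nonzero_divide_eq_eq)+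
    have "c * (z * z * c + b) = 0" "c' * (z * z * c' + b') = 0"
      using det det' unfolding a by Groebner_Basis.algebra+
    then have "b = - (z * z * c)" "b' = - (z * z * c')"
      using c by (auto simp: add_eq_0_iff)
    then show ?thesis by (simp add: mat2_eq_iff mat2_mult_nth u v a algebra_simps)
  qed
qed

section \<open>The group \<open>GL2 A\<close> over a ring with fraction field K\<close>

locale cusp_ring =
  fixes A :: "'k::field set"
  assumes zero_mem: "0 \<in> A" and one_mem: "1 \<in> A"
    and add_mem: "x \<in> A \<Longrightarrow> y \<in> A \<Longrightarrow> x + y \<in> A"
    and mult_mem: "x \<in> A \<Longrightarrow> y \<in> A \<Longrightarrow> x * y \<in> A"
    and uminus_mem: "x \<in> A \<Longrightarrow> - x \<in> A"
    and fraction: "\<exists>a\<in>A. \<exists>b\<in>A. b \<noteq> 0 \<and> z = a / b"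
    and char_pos: "CHAR('k) > 0"
begin

abbreviation "G \<equiv> GL2 A"

lemma monoid_M2: "Group.monoid (M2 A)"
proof (rule monoidI)
  show "x \<otimes>\<^bsub>M2 A\<^esub> y \<in> carrier (M2 A)" if "x \<in> carrier (M2 A)" "y \<in> carrier (M2 A)" for x y
    using that by (auto simp: M2_def mat2_mult_nth intro!: add_mem mult_mem)
  show "\<one>\<^bsub>M2 A\<^esub> \<in> carrier (M2 A)"
    by (auto simp: M2_def mat_def zero_mem one_mem)
qed (auto simp: M2_def matrix_mul_assoc)

sublocale group G
  unfolding GL2_def using monoid_M2 by (rule monoid.units_group)

lemma mult_G [simp]: "x \<otimes>\<^bsub>G\<^esub> y = x ** y"
  by (simp add: GL2_def units_of_mult M2_def)

lemma one_G [simp]: "\<one>\<^bsub>G\<^esub> = mat 1"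
  by (simp add: GL2_def units_of_one M2_def)

lemma det_G: "det g \<noteq> 0" if "g \<in> carrier G"
proof
  assume "det g = 0"
  have "det (g ** inv\<^bsub>G\<^esub> g) = 1"
    using r_inv[OF that] by simp
  with \<open>det g = 0\<close> show False by (simp add: det_mul)
qed

lemma carrier_GI:
  assumes "\<And>i j. g $ i $ j \<in> A" "\<And>i j. h $ i $ j \<in> A" "g ** h = mat 1" "h ** g = mat 1"
  shows "g \<in> carrier G"
  using assms unfolding GL2_def units_of_carrier Units_def by (auto simp: M2_def)

lemma moebius_mult_G: "moebius (g ** h) s = moebius g (moebius h s)" if "h \<in> carrier G"
  using that by (intro moebius_mult det_G)

lemma moebius_inv: "moebius (inv\<^bsub>G\<^esub> g) (moebius g s) = s" if "g \<in> carrier G"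
proof -
  have "inv\<^bsub>G\<^esub> g ** g = mat 1" using l_inv[OF that] by simp
  then show ?thesis using moebius_mult_G[OF that, of "inv\<^bsub>G\<^esub> g" s] by simp
qed

lemma prime_char: "Factorial_Ring.prime CHAR('k)"
  using char_pos by (rule prime_CHAR_semidom)

text \<open>Since (u - 1)^2 = 0, the k-th power of u is 1 + k (u - 1).\<close>

lemma unipotent_pow:
  assumes "unipotent u" "u \<in> carrier G"
  shows "u [^]\<^bsub>G\<^esub> CHAR('k) = mat 1"
proof -
  obtain a b c where u: "u $ 1 $ 1 = 1 + a" "u $ 1 $ 2 = b" "u $ 2 $ 1 = c" "u $ 2 $ 2 = 1 - a"
    and det: "a * a + b * c = 0"
    using unipotent_entries[OF assms(1)] by metis
  have step: "(1 + n * a) * (1 + a) + n * b * c = 1 + (1 + n) * a"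
    "(1 + n * a) * b + n * b * (1 - a) = (1 + n) * b"
    "n * c * (1 + a) + (1 - n * a) * c = (1 + n) * c"
    "n * c * b + (1 - n * a) * (1 - a) = 1 - (1 + n) * a" for n
    using det by Groebner_Basis.algebra+
  have "(u [^]\<^bsub>G\<^esub> k) $ 1 $ 1 = 1 + of_nat k * a \<and> (u [^]\<^bsub>G\<^esub> k) $ 1 $ 2 = of_nat k * b \<and>
      (u [^]\<^bsub>G\<^esub> k) $ 2 $ 1 = of_nat k * c \<and> (u [^]\<^bsub>G\<^esub> k) $ 2 $ 2 = 1 - of_nat k * a" for k
  proof (induction k)
    case 0
    then show ?case by simp
  next
    case (Suc k)
    show ?case
      using Suc step[of "of_nat k"] by (simp add: mat2_mult_nth u)
  qed
  from this[of "CHAR('k)"] show ?thesis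
    by (simp add: mat2_eq_iff)
qed

text \<open>An eigenvalue \<open>\<lambda>\<close> of \<open>u\<close> satisfies \<open>\<lambda>\<^sup>p = 1\<close>, hence \<open>(\<lambda> - 1)\<^sup>p = 0\<close>.\<close>

lemma pow_unipotent:
  assumes "u \<in> carrier G" "u [^]\<^bsub>G\<^esub> CHAR('k) = mat 1" "u \<noteq> mat 1"
  shows "unipotent u"
proof -
  define T D where "T = u $ 1 $ 1 + u $ 2 $ 2" and "D = det u"
  let ?p = "CHAR('k)"
  let ?root = "\<lambda>l. l * l = to_ac T * l - to_ac D"
  have char_ac: "CHAR('k alg_closure) = ?p" by simp
  \<comment> \<open>\<alpha> X + \<beta> is the remainder of X^k modulo the characteristic
    polynomial, so the same coefficients serve for the matrix, by Cayley-Hamilton, and for its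
    eigenvalues \<open>l\<close> in the algebraic closure.\<close>
  have pow: "\<exists>\<alpha> \<beta>. (\<forall>i j. (u [^]\<^bsub>G\<^esub> k) $ i $ j = \<alpha> * u $ i $ j + \<beta> * (mat 1 $ i $ j)) \<and>
      (\<forall>l. ?root l \<longrightarrow> l ^ k = to_ac \<alpha> * l + to_ac \<beta>)" for k :: nat
  proof (induction k)
    case 0
    then show ?case by (intro exI[of _ 0] exI[of _ 1]) simp
  next
    case (Suc k)
    then obtain \<alpha> \<beta> where *: "\<And>i j. (u [^]\<^bsub>G\<^esub> k) $ i $ j = \<alpha> * u $ i $ j + \<beta> * (mat 1 $ i $ j)"
      "\<And>l. ?root l \<Longrightarrow> l ^ k = to_ac \<alpha> * l + to_ac \<beta>" by blast
    have "(u [^]\<^bsub>G\<^esub> Suc k) $ i $ j = (\<alpha> * T + \<beta>) * u $ i $ j + (- \<alpha> * D) * (mat 1 $ i $ j)" for i j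
      using exhaust_2[of i] exhaust_2[of j]
      by (auto simp: mat2_mult_nth * T_def D_def det_2 algebra_simps)
    moreover have "l ^ Suc k = to_ac (\<alpha> * T + \<beta>) * l + to_ac (- \<alpha> * D)" if "?root l" for l
    proof -
      have "l ^ Suc k = to_ac \<alpha> * (l * l) + to_ac \<beta> * l"
        by (simp add: *(2)[OF that] algebra_simps)
      then show ?thesis unfolding that by (simp add: algebra_simps)
    qed
    ultimately show ?case by blast
  qed
  obtain \<alpha> \<beta> where *: "\<And>i j. (mat 1 :: 'k^2^2) $ i $ j = \<alpha> * u $ i $ j + \<beta> * (mat 1 $ i $ j)"
    and root: "\<And>l. ?root l \<Longrightarrow> l ^ ?p = to_ac \<alpha> * l + to_ac \<beta>"
    using pow[of ?p] unfolding assms(2) by blast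
  have root_one: "l = 1" if "l ^ ?p = 1" for l :: "'k alg_closure"
  proof -
    have "((l - 1) + 1 :: 'k alg_closure) ^ ?p = (l - 1) ^ ?p + 1 ^ ?p"
      by (rule freshmans_dream) (simp_all add: prime_char)
    then have "(l - 1) ^ ?p = 0" using that by simp
    then show ?thesis by simp
  qed
  \<comment> \<open>Otherwise \<open>u\<close> would be a scalar matrix whose entry d satisfies d^p
    = 1, so d = 1.\<close>
  have "\<alpha> = 0"
  proof (rule ccontr)
    assume nz: "\<alpha> \<noteq> 0"
    define d where "d = u $ 1 $ 1"
    have offdiag: "u $ 1 $ 2 = 0" "u $ 2 $ 1 = 0"
      using *[of 1 2] *[of 2 1] nz by auto
    have "\<alpha> * u $ 1 $ 1 + \<beta> = 1" "\<alpha> * u $ 2 $ 2 + \<beta> = 1"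
      using *[of 1 1] *[of 2 2] by simp_all
    then have "\<alpha> * u $ 1 $ 1 = \<alpha> * u $ 2 $ 2"
      by (metis add_right_cancel)
    then have diag: "u $ 2 $ 2 = d" using nz by (simp add: d_def)
    have "(u [^]\<^bsub>G\<^esub> k) $ 1 $ 1 = d ^ k" for k :: nat
      by (induction k) (simp_all add: mat2_mult_nth d_def offdiag mult.commute)
    from this[of ?p] have "to_ac d ^ ?p = 1"
      unfolding assms(2) by (simp flip: to_ac_power)
    then have "d = 1" using root_one[of "to_ac d"] by simp
    with offdiag diag assms(3) show False by (simp add: mat2_eq_iff d_def)
  qed
  then have "\<beta> = 1" using *[of 1 1] by simp
  have root_eq: "l = 1" if "?root l" for l
    using root[OF that] \<open>\<alpha> = 0\<close> \<open>\<beta> = 1\<close> root_one by simp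
  have "\<exists>l. poly [: to_ac D, - to_ac T, 1 :] l = 0"
    by (rule alg_closed_imp_poly_has_root) simp
  then obtain l where l: "to_ac D + l * (l - to_ac T) = 0" by auto
  \<comment> \<open>The two eigenvalues are \<open>l\<close> and T - l; both being 1 determines
    trace and determinant.\<close>
  have l1: "?root l" and l2: "?root (to_ac T - l)"
    using l by Groebner_Basis.algebra+
  have "l = 1" "to_ac T - l = 1" using root_eq[OF l1] root_eq[OF l2] by blast+
  then have T: "to_ac T = 2" by (metis diff_add_cancel one_add_one)
  have "1 = to_ac T - to_ac D" using l1 unfolding \<open>l = 1\<close> by simp
  then have D: "to_ac D = 1" unfolding T by (metis add_diff_cancel_left' diff_diff_eq2 one_add_one)
  have "to_ac T = to_ac 2" using T by simp
  then have "T = 2" unfolding to_ac_eq_iff .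
  moreover have "D = 1" using D by simp
  ultimately show ?thesis using assms(3) by (simp add: unipotent_def T_def D_def)
qed

text \<open>The column (x, y) representing s spans kernel and image of (x, y)^T (y, -x), and
  \<open>M e\<close> is 1 plus e times this matrix. So \<open>M 1\<close> fixes s and has inverse
  \<open>M (- 1)\<close>.\<close>

lemma stab_has_unipotent: "\<exists>u\<in>stab A s. unipotent u"
proof -
  obtain x y where xy: "x \<in> A" "y \<in> A" "x \<noteq> 0 \<or> y \<noteq> 0" "s = (if y = 0 then None else Some (x / y))"
  proof (cases s)
    case None
    then show ?thesis using that[of 1 0] by (simp add: zero_mem one_mem)
  next
    case (Some z)
    then show ?thesis using fraction[of z] that by auto
  qed
  define M where "M = (\<lambda>e. \<chi> i j. if i = 1 then (if j = 1 then 1 + e * (x * y) else - (e * (x * x)))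
    else (if j = 1 then e * (y * y) else 1 - e * (x * y)) :: 'k^2^2)"
  have M: "M e $ 1 $ 1 = 1 + e * (x * y)" "M e $ 1 $ 2 = - (e * (x * x))"
    "M e $ 2 $ 1 = e * (y * y)" "M e $ 2 $ 2 = 1 - e * (x * y)" for e
    by (simp_all add: M_def)
  have mem: "M e $ i $ j \<in> A" if "e = 1 \<or> e = - 1" for e i j
  proof -
    have e: "e \<in> A" using that one_mem uminus_mem by auto
    have m: "e * (a * b) \<in> A" if "a \<in> A" "b \<in> A" for a b
      using that e by (intro mult_mem)
    have "1 + e * (x * y) \<in> A" "1 + - (e * (x * y)) \<in> A"
      using m[OF xy(1,2)] by (intro add_mem one_mem uminus_mem; assumption)+
    then have "M e $ 1 $ 1 \<in> A" "M e $ 2 $ 2 \<in> A" by (simp_all add: M)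
    moreover have "M e $ 1 $ 2 \<in> A" "M e $ 2 $ 1 \<in> A"
      unfolding M using m[OF xy(1,1)] m[OF xy(2,2)] by (simp_all add: uminus_mem)
    ultimately show ?thesis
      using exhaust_2[of i] exhaust_2[of j] by metis
  qed
  have prod: "M e ** M e' = mat 1" if "e + e' = 0" for e e'
    unfolding mat2_eq_iff mat2_mult_nth M mat2_one_nth
    using that by (intro conjI; Groebner_Basis.algebra)
  have "M 1 \<in> carrier G"
    by (rule carrier_GI[of _ "M (- 1)"]) (use mem prod in simp_all)
  moreover have uni: "unipotent (M 1)"
    unfolding unipotent_def
  proof (intro conjI)
    show "M 1 \<noteq> mat 1" using xy(3) by (auto simp: mat2_eq_iff M)
    show "M 1 $ 1 $ 1 + M 1 $ 2 $ 2 = 2" by (simp add: M)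
    show "det (M 1) = 1" by (simp add: det_2 M algebra_simps)
  qed
  moreover have "moebius (M 1) s = s"
    unfolding unipotent_fixpoint[OF uni] M xy(4) using xy(3) by simp
  ultimately show ?thesis by (auto simp: stab_def stabilizer_def)
qed

section \<open>Transport of unipotents and stabilizers by automorphisms\<close>

lemma unipotent_iff:
  "u \<in> carrier G \<Longrightarrow> unipotent u \<longleftrightarrow> u \<noteq> \<one>\<^bsub>G\<^esub> \<and> u [^]\<^bsub>G\<^esub> CHAR('k) = \<one>\<^bsub>G\<^esub>"
  unfolding one_G using unipotent_pow pow_unipotent unipotent_def by metis

lemma mem_stab: "g \<in> stab A s \<longleftrightarrow> g \<in> carrier G \<and> moebius g s = s"
  by (simp add: stab_def stabilizer_def)

text \<open>An injective homomorphism preserves order p. Membership in \<open>auto G\<close> would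
  be too narrow an assumption: it demands extensional maps, and the conjugation in
  \<open>conj_unipotent\<close> is not restricted to the carrier.\<close>

lemma hom_unipotent:
  assumes "\<sigma> \<in> hom G G" "inj_on \<sigma> (carrier G)" "unipotent u" "u \<in> carrier G"
  shows "unipotent (\<sigma> u)"
proof -
  interpret \<sigma>: group_hom G G \<sigma>
    using assms(1) by unfold_locales
  have "\<sigma> u [^]\<^bsub>G\<^esub> CHAR('k) = \<one>\<^bsub>G\<^esub>"
    using \<sigma>.hom_nat_pow[OF assms(4), of "CHAR('k)"] unipotent_iff[OF assms(4)] assms(3) \<sigma>.hom_one by simp
  moreover have "\<sigma> u \<noteq> \<one>\<^bsub>G\<^esub>"
    using unipotent_iff[OF assms(4)] assms(2-4) \<sigma>.hom_one by (metis inj_onD one_closed)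
  ultimately show ?thesis
    using unipotent_iff[of "\<sigma> u"] assms(4) by simp
qed

lemma conj_unipotent:
  assumes "unipotent u" "u \<in> carrier G" "g \<in> carrier G"
  shows "unipotent (g ** u ** inv\<^bsub>G\<^esub> g)"
proof -
  let ?c = "\<lambda>x. g \<otimes>\<^bsub>G\<^esub> x \<otimes>\<^bsub>G\<^esub> inv\<^bsub>G\<^esub> g"
  have "?c \<in> hom G G"
  proof (rule homI)
    fix x y assume "x \<in> carrier G" "y \<in> carrier G"
    then show "?c (x \<otimes>\<^bsub>G\<^esub> y) = ?c x \<otimes>\<^bsub>G\<^esub> ?c y"
      using assms(3) by (simp add: m_assoc inv_solve_left del: mult_G)
  qed (use assms in \<open>auto simp del: mult_G\<close>)
  moreover have "inj_on ?c (carrier G)"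
    by (rule inj_onI) (use assms in \<open>auto simp del: mult_G\<close>)
  ultimately show ?thesis
    using hom_unipotent[of ?c u] assms by simp
qed

lemma moebius_conj:
  assumes "u \<in> carrier G" "g \<in> carrier G" "moebius u s = s"
  shows "moebius (g ** u ** inv\<^bsub>G\<^esub> g) (moebius g s) = moebius g s"
  using assms by (simp add: moebius_mult_G moebius_inv)

text \<open>If g u g^-1 commutes with u, then u permutes the fixed points of g u g^-1. The only one
  is g s, so u fixes g s, and therefore g s = s.\<close>

lemma stab_eq:
  assumes "unipotent u" "u \<in> stab A s"
  shows "stab A s = {g \<in> carrier G. (g \<otimes>\<^bsub>G\<^esub> u \<otimes>\<^bsub>G\<^esub> inv\<^bsub>G\<^esub> g) \<otimes>\<^bsub>G\<^esub> u = u \<otimes>\<^bsub>G\<^esub> (g \<otimes>\<^bsub>G\<^esub> u \<otimes>\<^bsub>G\<^esub> inv\<^bsub>G\<^esub> g)}"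
proof -
  have u: "u \<in> carrier G" "moebius u s = s" using assms(2) by (auto simp: mem_stab)
  have "moebius g s = s \<longleftrightarrow> (g ** u ** inv\<^bsub>G\<^esub> g) ** u = u ** (g ** u ** inv\<^bsub>G\<^esub> g)" if g: "g \<in> carrier G" for g
  proof -
    define v where "v = g ** u ** inv\<^bsub>G\<^esub> g"
    have v: "unipotent v" "v \<in> carrier G" "moebius v (moebius g s) = moebius g s"
      unfolding v_def using conj_unipotent[OF assms(1) u(1) g] moebius_conj[OF u(1) g u(2)]
        m_closed[OF m_closed[OF g u(1)] inv_closed[OF g]] by auto
    have "moebius g s = s" if "v ** u = u ** v"
    proof -
      have "moebius v (moebius u (moebius g s)) = moebius u (moebius g s)"
        using that v u by (metis moebius_mult_G)
      then have "moebius u (moebius g s) = moebius g s"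
        using unipotent_fixpoint[OF v(1)] v(3) by metis
      then show ?thesis using unipotent_fixpoint[OF assms(1)] u(2) by metis
    qed
    moreover have "v ** u = u ** v" if "moebius g s = s"
      using unipotents_commute[OF v(1) assms(1), of s] v(3) u(2) that by simp
    ultimately show ?thesis unfolding v_def by blast
  qed
  then show ?thesis by (auto simp: mem_stab)
qed

lemma stab_inj: "stab A s = stab A t \<Longrightarrow> s = t"
  using stab_has_unipotent[of s] unipotent_fixpoint by (metis mem_stab)

text \<open>The point s' is the fixed point of \<sigma> u, for u a unipotent in the stabilizer of s;
  \<open>stab_eq\<close> describes both stabilizers by the same formula.\<close>

lemma auto_image_stab:
  assumes "\<sigma> \<in> auto G"
  shows "\<exists>!s'. \<sigma> ` stab A s = stab A s'"
proof (rule ex_ex1I)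
  have \<sigma>: "\<sigma> \<in> hom G G" "bij_betw \<sigma> (carrier G) (carrier G)"
    using assms by (auto simp: auto_def Bij_def)
  interpret \<sigma>: group_hom G G \<sigma>
    using \<sigma>(1) by unfold_locales
  have inj: "inj_on \<sigma> (carrier G)" and surj: "\<sigma> ` carrier G = carrier G"
    using \<sigma>(2) by (auto simp: bij_betw_def)
  obtain u where u: "u \<in> stab A s" "unipotent u" using stab_has_unipotent by blast
  have uG: "u \<in> carrier G" using u by (simp add: mem_stab)
  define v where "v = \<sigma> u"
  have v: "unipotent v" "v \<in> carrier G"
    using hom_unipotent[OF \<sigma>(1) inj u(2) uG] uG by (auto simp: v_def)
  obtain s' where "moebius v s' = s'" using unipotent_fixpoint[OF v(1)] by blast
  then have "v \<in> stab A s'" using v by (simp add: mem_stab)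
  note s' = stab_eq[OF v(1) this] 
  have eq: "(\<sigma> g \<otimes>\<^bsub>G\<^esub> v \<otimes>\<^bsub>G\<^esub> inv\<^bsub>G\<^esub> \<sigma> g) \<otimes>\<^bsub>G\<^esub> v = v \<otimes>\<^bsub>G\<^esub> (\<sigma> g \<otimes>\<^bsub>G\<^esub> v \<otimes>\<^bsub>G\<^esub> inv\<^bsub>G\<^esub> \<sigma> g) \<longleftrightarrow>
     (g \<otimes>\<^bsub>G\<^esub> u \<otimes>\<^bsub>G\<^esub> inv\<^bsub>G\<^esub> g) \<otimes>\<^bsub>G\<^esub> u = u \<otimes>\<^bsub>G\<^esub> (g \<otimes>\<^bsub>G\<^esub> u \<otimes>\<^bsub>G\<^esub> inv\<^bsub>G\<^esub> g)" (is "?l = ?r \<longleftrightarrow> ?l' = ?r'")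
    if "g \<in> carrier G" for g
  proof -
    have "?l = \<sigma> ?l'" "?r = \<sigma> ?r'"
      using that uG by (simp_all add: v_def del: mult_G)
    moreover have "?l' \<in> carrier G" "?r' \<in> carrier G" using that uG by (simp_all del: mult_G)
    ultimately show ?thesis using inj by (metis inj_onD)
  qed
  have image_Collect: "\<sigma> ` {g \<in> carrier G. P g} = {h \<in> carrier G. Q h}"
    if "\<And>g. g \<in> carrier G \<Longrightarrow> Q (\<sigma> g) \<longleftrightarrow> P g" for P Q
  proof -
    have "{h \<in> carrier G. Q h} = {h \<in> \<sigma> ` carrier G. Q h}" by (simp only: surj)
    also have "\<dots> = \<sigma> ` {g \<in> carrier G. P g}" using that by auto
    finally show ?thesis ..
  qed
  have "\<sigma> ` stab A s = stab A s'"
    unfolding s' stab_eq[OF u(2,1)] by (rule image_Collect) (rule eq)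
  then show "\<exists>s'. \<sigma> ` stab A s = stab A s'" ..
qed (metis stab_inj)

lemma stab_moebius:
  assumes "g \<in> carrier G"
  shows "stab A (moebius g s) = (\<lambda>h. g \<otimes>\<^bsub>G\<^esub> h \<otimes>\<^bsub>G\<^esub> inv\<^bsub>G\<^esub> g) ` stab A s"
proof (intro equalityI subsetI)
  fix h assume h: "h \<in> stab A (moebius g s)"
  let ?k = "inv\<^bsub>G\<^esub> g \<otimes>\<^bsub>G\<^esub> h \<otimes>\<^bsub>G\<^esub> g"
  have hG: "h \<in> carrier G" using h by (simp add: mem_stab)
  have "g \<otimes>\<^bsub>G\<^esub> ?k \<otimes>\<^bsub>G\<^esub> inv\<^bsub>G\<^esub> g = (g \<otimes>\<^bsub>G\<^esub> inv\<^bsub>G\<^esub> g) \<otimes>\<^bsub>G\<^esub> h \<otimes>\<^bsub>G\<^esub> (g \<otimes>\<^bsub>G\<^esub> inv\<^bsub>G\<^esub> g)"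
    using hG assms by (simp only: m_assoc m_closed inv_closed)
  then have eq: "g \<otimes>\<^bsub>G\<^esub> ?k \<otimes>\<^bsub>G\<^esub> inv\<^bsub>G\<^esub> g = h"
    using hG assms by (simp del: mult_G one_G)
  have mem: "?k \<in> stab A s"
  proof -
    have k: "?k \<in> carrier G" using hG assms by (simp del: mult_G)
    have "moebius h (moebius g s) = moebius g s" using h by (simp add: mem_stab)
    then have "moebius ?k s = s"
      using hG assms by (simp add: moebius_mult_G moebius_inv)
    with k show ?thesis unfolding mem_stab by blast
  qed
  show "h \<in> (\<lambda>h. g \<otimes>\<^bsub>G\<^esub> h \<otimes>\<^bsub>G\<^esub> inv\<^bsub>G\<^esub> g) ` stab A s" 
    by (rule rev_image_eqI[OF mem]) (rule eq[symmetric])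
next
  fix h assume "h \<in> (\<lambda>h. g \<otimes>\<^bsub>G\<^esub> h \<otimes>\<^bsub>G\<^esub> inv\<^bsub>G\<^esub> g) ` stab A s"
  then obtain k where k: "k \<in> carrier G" "moebius k s = s" "h = g \<otimes>\<^bsub>G\<^esub> k \<otimes>\<^bsub>G\<^esub> inv\<^bsub>G\<^esub> g"
    by (auto simp: mem_stab)
  have "h \<in> carrier G" using k assms by (simp del: mult_G)
  with k moebius_conj[OF k(1) assms k(2)] show "h \<in> stab A (moebius g s)"
    by (simp add: mem_stab)
qed

section \<open>The induced permutations of the cusps\<close>

lemma cusp_eq_iff: "cusp A s = cusp A t \<longleftrightarrow> (\<exists>g\<in>carrier G. t = moebius g s)"
proof
  assume "cusp A s = cusp A t"
  moreover have "t \<in> cusp A t"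
    unfolding cusp_def orbit_def using one_closed by (auto intro!: exI[of _ "mat 1"])
  ultimately show "\<exists>g\<in>carrier G. t = moebius g s"
    by (auto simp: cusp_def orbit_def)
next
  have *: "cusp A (moebius g s) \<subseteq> cusp A s" if "g \<in> carrier G" for g s
  proof
    fix x assume "x \<in> cusp A (moebius g s)"
    then obtain h where "h \<in> carrier G" "x = moebius h (moebius g s)"
      by (auto simp: cusp_def orbit_def)
    then have "x = moebius (h ** g) s" "h ** g \<in> carrier G"
      using that moebius_mult_G[OF that] m_closed[of h g] by simp_all
    then show "x \<in> cusp A s" unfolding cusp_def orbit_def by blast
  qed
  assume "\<exists>g\<in>carrier G. t = moebius g s"
  then obtain g where g: "g \<in> carrier G" "t = moebius g s" by blast
  have "cusp A s \<subseteq> cusp A t"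
    using *[OF inv_closed[OF g(1)], of t] g moebius_inv by simp
  with *[OF g(1), of s] g show "cusp A s = cusp A t" by auto
qed

lemma auto_cusp_eq:
  assumes "\<sigma> \<in> auto G" "\<sigma> ` stab A s = stab A s'" "\<sigma> ` stab A t = stab A t'" "cusp A s = cusp A t"
  shows "cusp A s' = cusp A t'"
proof -
  have \<sigma>: "\<sigma> \<in> hom G G" using assms by (auto simp: auto_def)
  interpret \<sigma>: group_hom G G \<sigma>
    using \<sigma>(1) by unfold_locales
  obtain g where g: "g \<in> carrier G" "t = moebius g s" using assms(4) cusp_eq_iff by blast
  have stabG: "stab A s \<subseteq> carrier G" by (auto simp: mem_stab)
  have "stab A t' = \<sigma> ` (\<lambda>h. g \<otimes>\<^bsub>G\<^esub> h \<otimes>\<^bsub>G\<^esub> inv\<^bsub>G\<^esub> g) ` stab A s"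
    using assms(3) g stab_moebius by metis
  also have "\<dots> = (\<lambda>h. \<sigma> g \<otimes>\<^bsub>G\<^esub> h \<otimes>\<^bsub>G\<^esub> inv\<^bsub>G\<^esub> \<sigma> g) ` \<sigma> ` stab A s"
    unfolding image_image using stabG g(1) by (intro image_cong) (auto simp del: mult_G)
  also have "\<dots> = stab A (moebius (\<sigma> g) s')"
    using stab_moebius[OF \<sigma>.hom_closed[OF g(1)]] assms(2) by metis
  finally have "t' = moebius (\<sigma> g) s'" by (rule stab_inj)
  then show ?thesis using g(1) cusp_eq_iff \<sigma>.hom_closed by blast
qed

text \<open>\<open>auto_cusp_eq\<close> is the uniqueness that the description operator in
  \<open>cusp_map\<close> calls for.\<close>

lemma cusp_map_cusp:
  assumes "\<sigma> \<in> auto G" "\<sigma> ` stab A s = stab A s'"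
  shows "cusp_map A \<sigma> (cusp A s) = cusp A s'"
proof -
  have "cusp A s \<in> cusps A" by (auto simp: cusps_def orbits_def cusp_def)
  moreover have "(THE C'. \<exists>t t'. cusp A s = cusp A t \<and> \<sigma> ` stab A t = stab A t' \<and> C' = cusp A t') = cusp A s'"
    using assms auto_cusp_eq by (intro the_equality) metis+
  ultimately show ?thesis by (simp add: cusp_map_def)
qed

lemma cuspsE: assumes "C \<in> cusps A" obtains s where "C = cusp A s"
  using assms by (auto simp: cusps_def orbits_def cusp_def)

lemma cusp_mem: "cusp A s \<in> cusps A"
  by (auto simp: cusps_def orbits_def cusp_def)

lemma cusp_map_mem:
  assumes "\<sigma> \<in> auto G" "C \<in> cusps A"
  shows "cusp_map A \<sigma> C \<in> cusps A"
  using assms by (metis cuspsE auto_image_stab cusp_map_cusp cusp_mem)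

lemma cusp_map_compose:
  assumes "\<sigma> \<in> auto G" "\<tau> \<in> auto G" "compose (carrier G) \<sigma> \<tau> \<in> auto G" "C \<in> cusps A"
  shows "cusp_map A (compose (carrier G) \<sigma> \<tau>) C = cusp_map A \<sigma> (cusp_map A \<tau> C)"
proof -
  obtain s where s: "C = cusp A s" using assms by (auto elim: cuspsE)
  obtain s' where s': "\<tau> ` stab A s = stab A s'" using auto_image_stab assms by blast
  obtain s'' where s'': "\<sigma> ` stab A s' = stab A s''" using auto_image_stab assms by blast
  have "stab A s \<subseteq> carrier G" by (auto simp: mem_stab)
  then have "compose (carrier G) \<sigma> \<tau> ` stab A s = \<sigma> ` \<tau> ` stab A s"
    unfolding image_image by (intro image_cong) (auto simp: compose_def)
  then have "compose (carrier G) \<sigma> \<tau> ` stab A s = stab A s''" by (simp add: s' s'')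
  then show ?thesis using assms s s' s'' by (simp add: cusp_map_cusp)
qed

lemma cusp_map_id:
  assumes "C \<in> cusps A"
  shows "cusp_map A (\<lambda>x\<in>carrier G. x) C = C"
proof -
  obtain s where s: "C = cusp A s" using assms by (auto elim: cuspsE)
  have "(\<lambda>x\<in>carrier G. x) ` stab A s = stab A s"
    by (auto simp: mem_stab image_iff)
  then show ?thesis using s cusp_map_cusp[OF id_in_auto] by blast
qed

lemma group_action_cusps: "group_action (AutoGroup G) (cusps A) (cusp_map A)"
proof -
  interpret Aut: group "AutoGroup G" by (rule AutoGroup)
  have car: "carrier (AutoGroup G) = auto G" by (simp add: AutoGroup_def)
  have mul: "\<sigma> \<otimes>\<^bsub>AutoGroup G\<^esub> \<tau> = compose (carrier G) \<sigma> \<tau>" if "\<sigma> \<in> auto G" "\<tau> \<in> auto G" for \<sigma> \<tau>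
    using that by (simp add: AutoGroup_def BijGroup_def auto_def)
  have one: "\<one>\<^bsub>AutoGroup G\<^esub> = (\<lambda>x\<in>carrier G. x)" by (simp add: AutoGroup_def BijGroup_def)
  have comp: "cusp_map A \<sigma> (cusp_map A \<tau> C) = cusp_map A (\<sigma> \<otimes>\<^bsub>AutoGroup G\<^esub> \<tau>) C"
    if "\<sigma> \<in> auto G" "\<tau> \<in> auto G" "C \<in> cusps A" for \<sigma> \<tau> C
    using that cusp_map_compose[of \<sigma> \<tau> C] Aut.m_closed[of \<sigma> \<tau>] by (simp add: car mul)
  have Bij: "cusp_map A \<sigma> \<in> Bij (cusps A)" if \<sigma>: "\<sigma> \<in> auto G" for \<sigma>
  proof -
    let ?\<tau> = "inv\<^bsub>AutoGroup G\<^esub> \<sigma>"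
    have \<tau>: "?\<tau> \<in> auto G" using Aut.inv_closed[of \<sigma>] \<sigma> by (simp add: car)
    have "bij_betw (cusp_map A \<sigma>) (cusps A) (cusps A)"
    proof (rule bij_betw_byWitness[where f' = "cusp_map A ?\<tau>"])
      show "\<forall>C\<in>cusps A. cusp_map A ?\<tau> (cusp_map A \<sigma> C) = C"
        using comp[OF \<tau> \<sigma>] Aut.l_inv[of \<sigma>] \<sigma> cusp_map_id by (simp add: car one)
      show "\<forall>C\<in>cusps A. cusp_map A \<sigma> (cusp_map A ?\<tau> C) = C"
        using comp[OF \<sigma> \<tau>] Aut.r_inv[of \<sigma>] \<sigma> cusp_map_id by (simp add: car one)
    qed (use cusp_map_mem \<sigma> \<tau> in auto)
    moreover have "cusp_map A \<sigma> \<in> extensional (cusps A)" by (simp add: cusp_map_def)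
    ultimately show ?thesis by (simp add: Bij_def)
  qed
  have "cusp_map A \<in> hom (AutoGroup G) (BijGroup (cusps A))"
  proof (rule homI)
    fix \<sigma> \<tau> assume "\<sigma> \<in> carrier (AutoGroup G)" "\<tau> \<in> carrier (AutoGroup G)"
    then have st: "\<sigma> \<in> auto G" "\<tau> \<in> auto G" by (auto simp: car)
    show "cusp_map A (\<sigma> \<otimes>\<^bsub>AutoGroup G\<^esub> \<tau>) = cusp_map A \<sigma> \<otimes>\<^bsub>BijGroup (cusps A)\<^esub> cusp_map A \<tau>"
    \<comment> \<open>Equality in \<open>BijGroup\<close> is equality of total functions, so the
      value \<open>undefined\<close> outside \<open>cusps A\<close> has to be compared as
      well.\<close>
    proof (rule ext)
      fix C
      have "(cusp_map A \<sigma> \<otimes>\<^bsub>BijGroup (cusps A)\<^esub> cusp_map A \<tau>) C =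
          (if C \<in> cusps A then cusp_map A \<sigma> (cusp_map A \<tau> C) else undefined)"
        using Bij[OF st(1)] Bij[OF st(2)] by (simp add: BijGroup_def compose_def)
      moreover have "cusp_map A (\<sigma> \<otimes>\<^bsub>AutoGroup G\<^esub> \<tau>) C = undefined" if "C \<notin> cusps A"
        using that by (simp add: cusp_map_def)
      ultimately show "cusp_map A (\<sigma> \<otimes>\<^bsub>AutoGroup G\<^esub> \<tau>) C =
          (cusp_map A \<sigma> \<otimes>\<^bsub>BijGroup (cusps A)\<^esub> cusp_map A \<tau>) C"
        using comp[OF st] by simp
    qed
  qed (simp add: car Bij BijGroup_def)
  then show ?thesis
    by (intro group_action.intro group_hom.intro Aut.group_axioms group_BijGroup group_hom_axioms.intro)
qed

theorem automorphisms_act_on_cusps: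
  "(\<forall>\<sigma>\<in>auto G.
      (\<forall>s. \<exists>!s'. \<sigma> ` stab A s = stab A s') \<and>
      (\<forall>s t s' t'. \<sigma> ` stab A s = stab A s' \<and> \<sigma> ` stab A t = stab A t' \<and>
          cusp A s = cusp A t \<longrightarrow> cusp A s' = cusp A t') \<and>
      (\<forall>s s'. \<sigma> ` stab A s = stab A s' \<longrightarrow> cusp_map A \<sigma> (cusp A s) = cusp A s') \<and>
      bij_betw (cusp_map A \<sigma>) (cusps A) (cusps A)) \<and>
   group_action (AutoGroup G) (cusps A) (cusp_map A)"
proof (rule conjI, rule ballI)
  fix \<sigma> assume \<sigma>: "\<sigma> \<in> auto G"
  have "bij_betw (cusp_map A \<sigma>) (cusps A) (cusps A)"
    using group_action.bij_prop0[OF group_action_cusps, of \<sigma>] \<sigma> by (simp add: AutoGroup_def Bij_def)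
  moreover have "\<forall>s t s' t'. \<sigma> ` stab A s = stab A s' \<and> \<sigma> ` stab A t = stab A t' \<and>
      cusp A s = cusp A t \<longrightarrow> cusp A s' = cusp A t'"
    by (intro allI impI, elim conjE) (rule auto_cusp_eq[OF \<sigma>])
  moreover have "\<forall>s s'. \<sigma> ` stab A s = stab A s' \<longrightarrow> cusp_map A \<sigma> (cusp A s) = cusp A s'"
    using cusp_map_cusp[OF \<sigma>] by blast
  ultimately show "(\<forall>s. \<exists>!s'. \<sigma> ` stab A s = stab A s') \<and>
      (\<forall>s t s' t'. \<sigma> ` stab A s = stab A s' \<and> \<sigma> ` stab A t = stab A t' \<and>
          cusp A s = cusp A t \<longrightarrow> cusp A s' = cusp A t') \<and>
      (\<forall>s s'. \<sigma> ` stab A s = stab A s' \<longrightarrow> cusp_map A \<sigma> (cusp A s) = cusp A s') \<and>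
      bij_betw (cusp_map A \<sigma>) (cusps A) (cusps A)"
    using auto_image_stab[OF \<sigma>] by blast
qed (rule group_action_cusps)

end

section \<open>Polynomials over a finite subfield\<close>

lemma pigeonhole_fiber:
  assumes "finite T" "g ` I \<subseteq> T" "finite I" "B * card T < card I"
  shows "\<exists>y\<in>T. B < card {i \<in> I. g i = y}"
proof (rule ccontr)
  assume "\<not> ?thesis"
  then have le: "card {i \<in> I. g i = y} \<le> B" if "y \<in> T" for y
    using that by (simp add: not_less)
  have "I = (\<Union>y\<in>T. {i \<in> I. g i = y})" using assms(2) by auto
  then have "card I \<le> (\<Sum>y\<in>T. card {i \<in> I. g i = y})"
    using card_UN_le[OF assms(1), of "\<lambda>y. {i \<in> I. g i = y}"] by simp
  also have "\<dots> \<le> (\<Sum>y\<in>T. B)" by (rule sum_mono) (rule le)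
  also have "\<dots> = B * card T" by simp
  finally show False using assms(4) by simp
qed

locale finite_subfield =
  fixes F :: "'k::field set"
  assumes finite_F: "finite F" and zero_F: "0 \<in> F" and one_F: "1 \<in> F"
    and add_F: "x \<in> F \<Longrightarrow> y \<in> F \<Longrightarrow> x + y \<in> F"
    and mult_F: "x \<in> F \<Longrightarrow> y \<in> F \<Longrightarrow> x * y \<in> F"
    and uminus_F: "x \<in> F \<Longrightarrow> - x \<in> F"
    and inverse_F: "x \<in> F \<Longrightarrow> inverse x \<in> F"
begin

definition polys :: "'k poly set" where
  "polys = {p. \<forall>i. Polynomial.coeff p i \<in> F}"

text \<open>Bounding coefficients instead of the degree makes \<open>polys_below 0\<close> consist
  of 0 alone, so that the cardinality is |F|^m for every m.\<close>

definition polys_below :: "nat \<Rightarrow> 'k poly set" where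
  "polys_below m = {p \<in> polys. \<forall>i\<ge>m. Polynomial.coeff p i = 0}"

lemma diff_F: "x \<in> F \<Longrightarrow> y \<in> F \<Longrightarrow> x - y \<in> F"
  using add_F[OF _ uminus_F] by fastforce

lemma sum_F: "(\<And>i. i \<in> I \<Longrightarrow> f i \<in> F) \<Longrightarrow> sum f I \<in> F"
  by (induction I rule: infinite_finite_induct) (auto simp: zero_F intro!: add_F)

lemma coeff_F: "p \<in> polys \<Longrightarrow> Polynomial.coeff p i \<in> F"
  by (simp add: polys_def)

lemma zero_polys: "0 \<in> polys" and one_polys: "1 \<in> polys"
  by (auto simp: polys_def zero_F one_F coeff_1)

lemma pCons_polys: "pCons c p \<in> polys \<longleftrightarrow> c \<in> F \<and> p \<in> polys"
proof -
  have "(\<forall>i. Polynomial.coeff (pCons c p) i \<in> F) \<longleftrightarrow>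
      Polynomial.coeff (pCons c p) 0 \<in> F \<and> (\<forall>i. Polynomial.coeff (pCons c p) (Suc i) \<in> F)"
    by (metis not0_implies_Suc)
  then show ?thesis by (simp add: polys_def)
qed

lemma add_polys: "p \<in> polys \<Longrightarrow> q \<in> polys \<Longrightarrow> p + q \<in> polys"
  by (simp add: polys_def add_F)

lemma diff_polys: "p \<in> polys \<Longrightarrow> q \<in> polys \<Longrightarrow> p - q \<in> polys"
  by (simp add: polys_def diff_F)

lemma uminus_polys: "p \<in> polys \<Longrightarrow> - p \<in> polys"
  by (simp add: polys_def uminus_F)

lemma mult_polys: "p \<in> polys \<Longrightarrow> q \<in> polys \<Longrightarrow> p * q \<in> polys"
  unfolding polys_def by (simp add: coeff_mult sum_F mult_F)

lemma prod_polys: "(\<And>i. i \<in> I \<Longrightarrow> f i \<in> polys) \<Longrightarrow> prod f I \<in> polys"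
  by (induction I rule: infinite_finite_induct) (auto simp: one_polys intro!: mult_polys)

lemma monom_polys: "Polynomial.monom 1 n \<in> polys"
  by (simp add: polys_def zero_F one_F)

lemma reflect_polys: "p \<in> polys \<Longrightarrow> reflect_poly p \<in> polys"
  by (simp add: polys_def coeff_reflect_poly zero_F)

lemma polys_below_Suc_iff: "p \<in> polys_below (Suc m) \<longleftrightarrow> p \<in> polys \<and> Polynomial.degree p \<le> m"
  unfolding polys_below_def using le_degree[of p]
  by (auto simp: Suc_le_eq coeff_eq_0 not_less intro: degree_le)

lemma polys_below_0: "polys_below 0 = {0}"
  by (auto simp: polys_below_def zero_polys poly_eq_iff)

lemma polys_below_Suc: "polys_below (Suc m) = (\<lambda>(c, p). pCons c p) ` (F \<times> polys_below m)"
proof (intro equalityI subsetI)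
  fix p assume p: "p \<in> polys_below (Suc m)"
  obtain c q where q: "p = pCons c q" by (metis pCons_cases)
  have "Polynomial.coeff q i = 0" if "i \<ge> m" for i
  proof -
    have "Polynomial.coeff p (Suc i) = 0" using p that unfolding polys_below_def by blast
    then show ?thesis by (simp add: q)
  qed
  moreover have "c \<in> F" "q \<in> polys" using p pCons_polys by (auto simp: polys_below_def q)
  ultimately have "(c, q) \<in> F \<times> polys_below m" by (simp add: polys_below_def)
  then show "p \<in> (\<lambda>(c, p). pCons c p) ` (F \<times> polys_below m)"
    by (rule rev_image_eqI) (simp add: q)
next
  fix p assume "p \<in> (\<lambda>(c, p). pCons c p) ` (F \<times> polys_below m)"
  then obtain c q where q: "p = pCons c q" "c \<in> F" "q \<in> polys_below m" by auto
  have "Polynomial.coeff p i = 0" if "i \<ge> Suc m" for i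
    using that q by (cases i) (auto simp: polys_below_def)
  then show "p \<in> polys_below (Suc m)"
    using q by (simp add: polys_below_def pCons_polys)
qed

lemma pCons_polys_below: "c \<in> F \<Longrightarrow> p \<in> polys_below m \<Longrightarrow> pCons c p \<in> polys_below (Suc m)"
  unfolding polys_below_Suc by (rule rev_image_eqI[of "(c, p)"]) simp_all

lemma finite_polys_below: "finite (polys_below m)"
  by (induction m) (simp_all add: polys_below_0 polys_below_Suc finite_F)

lemma card_polys_below: "card (polys_below m) = card F ^ m"
proof (induction m)
  case (Suc m)
  have "inj_on (\<lambda>(c, p). pCons c p) (F \<times> polys_below m)"
    by (auto simp: inj_on_def)
  then show ?case by (simp add: polys_below_Suc card_image card_cartesian_product Suc)
qed (simp add: polys_below_0)

lemma card_F: "card F \<ge> 2"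
proof -
  have "card {0, 1 :: 'k} \<le> card F" by (rule card_mono) (auto simp: finite_F zero_F one_F)
  then show ?thesis by simp
qed

lemma diff_polys_below: "p \<in> polys_below m \<Longrightarrow> q \<in> polys_below m \<Longrightarrow> p - q \<in> polys_below m"
  by (simp add: polys_below_def diff_polys)

lemma polys_below_polys: "p \<in> polys_below m \<Longrightarrow> p \<in> polys"
  by (simp add: polys_below_def)

lemma card_PiE_polys_below: "card (PiE {..<n::nat} (\<lambda>_. polys_below m)) = card F ^ (n * m)"
  by (simp add: card_PiE card_polys_below power_mult mult.commute[of n])

lemma finite_PiE_polys_below: "finite (PiE {..<n::nat} (\<lambda>_. polys_below m))"
  by (simp add: finite_PiE finite_polys_below)

text \<open>At a \<open>w\<close> in a maximal ideal this splits p(w) into a power of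
  \<open>w\<close> and a unit, see \<open>poly_unit\<close>.\<close>

lemma split_X_power:
  assumes "p \<in> polys" "p \<noteq> 0"
  obtains c g where "g \<in> polys" "Polynomial.coeff g 0 \<noteq> 0" "p = Polynomial.monom 1 c * g"
proof -
  have "\<exists>c g. g \<in> polys \<and> Polynomial.coeff g 0 \<noteq> 0 \<and> p = Polynomial.monom 1 c * g"
    using assms
  proof (induction p)
    case (pCons a p)
    show ?case
    proof (cases "a = 0")
      case True
      then obtain c g where "g \<in> polys" "Polynomial.coeff g 0 \<noteq> 0" "p = Polynomial.monom 1 c * g"
        using pCons by (metis pCons_polys pCons_0_0)
      then show ?thesis
        using True by (intro exI[of _ "Suc c"] exI[of _ g]) (simp add: monom_Suc)
    next
      case False
      then show ?thesis
        using pCons.prems by (intro exI[of _ 0] exI[of _ "pCons a p"]) (simp add: monom_0)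
    qed
  qed simp
  then show thesis using that by blast
qed

section \<open>Transcendence over F and linear independence over F(w)\<close>

definition transc :: "'k \<Rightarrow> bool" where
  "transc x \<longleftrightarrow> (\<forall>p\<in>polys. poly p x = 0 \<longrightarrow> p = 0)"

lemma transcD: "transc x \<Longrightarrow> p \<in> polys \<Longrightarrow> p \<noteq> 0 \<Longrightarrow> poly p x \<noteq> 0"
  by (auto simp: transc_def)

text \<open>Linear independence over F(w) with denominators cleared. The coefficients must vanish as
  polynomials, so a nonempty independent family also forces \<open>w\<close> to be
  transcendental.\<close>

definition indep :: "'k \<Rightarrow> nat \<Rightarrow> (nat \<Rightarrow> 'k) \<Rightarrow> bool" where
  "indep w k u \<longleftrightarrow> (\<forall>p. (\<forall>i<k. p i \<in> polys) \<longrightarrow> (\<Sum>i<k. poly (p i) w * u i) = 0 \<longrightarrow> (\<forall>i<k. p i = 0))"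

lemma indepD:
  "indep w k u \<Longrightarrow> (\<And>i. i < k \<Longrightarrow> p i \<in> polys) \<Longrightarrow> (\<Sum>i<k. poly (p i) w * u i) = 0 \<Longrightarrow> i < k \<Longrightarrow> p i = 0"
  unfolding indep_def by blast

text \<open>A nontrivial relation can be divided by the common power of \<open>w\<close> in its coefficients.\<close>

lemma indepI_constant_terms:
  assumes "w \<noteq> 0"
    and rel: "\<And>p i. (\<And>i. i < k \<Longrightarrow> p i \<in> polys) \<Longrightarrow> (\<Sum>i<k. poly (p i) w * u i) = 0 \<Longrightarrow> i < k \<Longrightarrow>
      Polynomial.coeff (p i) 0 = 0"
  shows "indep w k u"
proof -
  have below: "\<forall>i<k. p i = 0"
    if "\<And>i. i < k \<Longrightarrow> p i \<in> polys_below m" "(\<Sum>i<k. poly (p i) w * u i) = 0" for p m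
    using that
  proof (induction m arbitrary: p)
    case 0
    then show ?case by (simp add: polys_below_0)
  next
    case (Suc m)
    have "\<exists>q. p i = pCons 0 q \<and> q \<in> polys_below m" if i: "i < k" for i
    proof -
      obtain c q where q: "p i = pCons c q" "q \<in> polys_below m"
        using Suc.prems(1)[OF i] unfolding polys_below_Suc by auto
      have "Polynomial.coeff (p i) 0 = 0"
        by (rule rel[OF polys_below_polys[OF Suc.prems(1)] Suc.prems(2) i])
      then show ?thesis using q by simp
    qed
    then obtain q where q: "\<And>i. i < k \<Longrightarrow> p i = pCons 0 (q i)" "\<And>i. i < k \<Longrightarrow> q i \<in> polys_below m"
      by metis
    have "(\<Sum>i<k. poly (p i) w * u i) = w * (\<Sum>i<k. poly (q i) w * u i)"
      unfolding sum_distrib_left by (rule sum.cong) (simp_all add: q(1) mult.assoc)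
    then have "(\<Sum>i<k. poly (q i) w * u i) = 0" using Suc.prems(2) assms(1) by simp
    from Suc.IH[OF q(2) this] show ?case using q(1) by simp
  qed
  have "\<forall>i<k. p i = 0" if p: "\<And>i. i < k \<Longrightarrow> p i \<in> polys" and s: "(\<Sum>i<k. poly (p i) w * u i) = 0" for p
  proof (rule below[OF _ s])
    fix i assume i: "i < k"
    have "Polynomial.degree (p i) \<le> (\<Sum>i<k. Polynomial.degree (p i))"
      using i by (intro member_le_sum) auto
    then show "p i \<in> polys_below (Suc (\<Sum>i<k. Polynomial.degree (p i)))"
      using p[OF i] by (simp add: polys_below_Suc_iff)
  qed
  then show ?thesis unfolding indep_def by blast
qed

end


section \<open>Function fields over a finite field\<close>

text \<open>\<open>V\<close> stands for the valuation rings, and \<open>v 0, \<dots>, v (N - 1)\<close> span the field over \<open>F(x)\<close>.\<close>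

locale function_field = finite_subfield F for F :: "'k::field set" +
  fixes V :: "'k set set" and x :: 'k and N :: nat and v :: "nat \<Rightarrow> 'k"
  assumes V_F: "R \<in> V \<Longrightarrow> a \<in> F \<Longrightarrow> a \<in> R"
    and V_add: "R \<in> V \<Longrightarrow> a \<in> R \<Longrightarrow> b \<in> R \<Longrightarrow> a + b \<in> R"
    and V_mult: "R \<in> V \<Longrightarrow> a \<in> R \<Longrightarrow> b \<in> R \<Longrightarrow> a * b \<in> R"
    and V_uminus: "R \<in> V \<Longrightarrow> a \<in> R \<Longrightarrow> - a \<in> R"
    and V_total: "R \<in> V \<Longrightarrow> z \<noteq> 0 \<Longrightarrow> z \<in> R \<or> inverse z \<in> R"
    and transc_x: "transc x"
    and generators: "\<exists>d c. d \<in> polys \<and> d \<noteq> 0 \<and> (\<forall>i<N. c i \<in> polys) \<and>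
      poly d x * z = (\<Sum>i<N. poly (c i) x * v i)"
    and transc: "t \<notin> F \<Longrightarrow> transc t"
begin

lemma common_denominator:
  fixes k :: nat
  shows "\<exists>d c D. d \<in> polys \<and> d \<noteq> 0 \<and> Polynomial.degree d \<le> D \<and>
    (\<forall>j<k. \<forall>i<N. c j i \<in> polys_below (Suc D)) \<and>
    (\<forall>j<k. poly d x * z j = (\<Sum>i<N. poly (c j i) x * v i))"
proof -
  have "\<forall>j. \<exists>d. \<exists>c. d \<in> polys \<and> d \<noteq> 0 \<and> (\<forall>i<N. c i \<in> polys) \<and>
      poly d x * z j = (\<Sum>i<N. poly (c i) x * v i)"
    by (rule allI, rule generators)
  from choice[OF this] obtain d where "\<forall>j. \<exists>c. d j \<in> polys \<and> d j \<noteq> 0 \<and> (\<forall>i<N. c i \<in> polys) \<and>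
      poly (d j) x * z j = (\<Sum>i<N. poly (c i) x * v i)" ..
  from choice[OF this] obtain c where dc: "\<forall>j. d j \<in> polys \<and> d j \<noteq> 0 \<and> (\<forall>i<N. c j i \<in> polys) \<and>
      poly (d j) x * z j = (\<Sum>i<N. poly (c j i) x * v i)" ..
  have d: "d j \<in> polys" "d j \<noteq> 0" and c: "i < N \<Longrightarrow> c j i \<in> polys"
    and dz: "poly (d j) x * z j = (\<Sum>i<N. poly (c j i) x * v i)" for j i
    using dc by simp_all
  define d' where "d' = prod d {..<k}"
  \<comment> \<open>\<open>e j\<close> is the cofactor of \<open>d j\<close> in the common
    denominator.\<close>
  define e where "e = (\<lambda>j. prod d ({..<k} - {j}))"
  define D where "D = Polynomial.degree d' + (\<Sum>j<k. \<Sum>i<N. Polynomial.degree (e j * c j i))"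
  have "d' \<in> polys" unfolding d'_def using d by (intro prod_polys) auto
  moreover have "d' \<noteq> 0" unfolding d'_def using d(2) by simp
  moreover have "Polynomial.degree d' \<le> D" by (simp add: D_def)
  moreover have "e j * c j i \<in> polys_below (Suc D)" if "j < k" "i < N" for j i
    proof -
      have "Polynomial.degree (e j * c j i) \<le> (\<Sum>i<N. Polynomial.degree (e j * c j i))"
        using that by (intro member_le_sum[where f = "\<lambda>i. Polynomial.degree (e j * c j i)"]) auto
      also have "\<dots> \<le> (\<Sum>j<k. \<Sum>i<N. Polynomial.degree (e j * c j i))"
        using that by (intro member_le_sum[where f = "\<lambda>j. \<Sum>i<N. Polynomial.degree (e j * c j i)"]) auto
      finally have "Polynomial.degree (e j * c j i) \<le> D" by (simp add: D_def)
      moreover have "e j \<in> polys" unfolding e_def using d by (intro prod_polys) auto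
      ultimately show ?thesis using c[OF that(2)] by (simp add: polys_below_Suc_iff mult_polys)
    qed
  moreover have "poly d' x * z j = (\<Sum>i<N. poly (e j * c j i) x * v i)" if "j < k" for j
    proof -
      have "d' = d j * e j" unfolding d'_def e_def using that by (intro prod.remove) auto
      then have "poly d' x * z j = poly (e j) x * (poly (d j) x * z j)" by simp
      then show ?thesis unfolding dz by (simp add: sum_distrib_left mult.assoc)
    qed
  ultimately show ?thesis
    by (intro exI[of _ d'] exI[of _ "\<lambda>j i. e j * c j i"] exI[of _ D]) simp
qed

text \<open>Counting values over the finite field \<open>F\<close> bounds the degree of the field over \<open>F(w)\<close>:
  \<open>k\<close> independent elements give at least \<open>|F|\<^bsup>k(m+1)\<^esup>\<close> combinations with coefficients of degree at most
  \<open>m\<close> in \<open>w\<close>, and these lie in a space of dimension \<open>O(m)\<close> over \<open>F\<close>.\<close>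

lemma indep_bounded: "\<exists>B. \<forall>k u. indep w k u \<longrightarrow> k \<le> B"
proof -
  obtain d r D where d: "d \<in> polys" "d \<noteq> 0" "Polynomial.degree d \<le> D"
    and r: "\<And>j i. j < N \<Longrightarrow> i < N \<Longrightarrow> r j i \<in> polys_below (Suc D)"
    and wv: "\<And>j. j < N \<Longrightarrow> poly d x * (w * v j) = (\<Sum>i<N. poly (r j i) x * v i)"
    using common_denominator[of N "\<lambda>j. w * v j"] by blast
  \<comment> \<open>\<open>L a\<close> is an F-space of dimension at most N (a + 1), and by
    \<open>wv\<close> multiplication by d(x) w maps it into \<open>L (a + D)\<close>.\<close>
  define L where "L = (\<lambda>a. {(\<Sum>i<N. poly (c i) x * v i) | c. \<forall>i<N. c i \<in> polys_below (Suc a)})"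
  have LI: "(\<Sum>i<N. poly (c i) x * v i) \<in> L a" if "\<And>i. i < N \<Longrightarrow> c i \<in> polys_below (Suc a)" for c a
    using that unfolding L_def by blast
  have LE: "\<exists>c. s = (\<Sum>i<N. poly (c i) x * v i) \<and> (\<forall>i<N. c i \<in> polys_below (Suc a))" if "s \<in> L a" for s a
    using that unfolding L_def by blast
  have L_mult: "poly g x * s \<in> L (a + b)" if s: "s \<in> L a" and g: "g \<in> polys" "Polynomial.degree g \<le> b" for g s a b
  proof -
    obtain c where c: "s = (\<Sum>i<N. poly (c i) x * v i)" "\<forall>i<N. c i \<in> polys_below (Suc a)"
      using LE[OF s] by blast
    have "poly g x * s = (\<Sum>i<N. poly (g * c i) x * v i)"
      by (simp add: c(1) sum_distrib_left mult.assoc)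
    also have "\<dots> \<in> L (a + b)"
    proof (rule LI)
      fix i assume "i < N"
      then have "c i \<in> polys" "Polynomial.degree (c i) \<le> a" using c(2) by (auto simp: polys_below_Suc_iff)
      then show "g * c i \<in> polys_below (Suc (a + b))"
        using g degree_mult_le[of g "c i"] by (simp add: polys_below_Suc_iff mult_polys)
    qed
    finally show ?thesis .
  qed
  have L_add: "s + s' \<in> L a" if s: "s \<in> L a" "s' \<in> L a" for s s' a
  proof -
    obtain c where c: "s = (\<Sum>i<N. poly (c i) x * v i)" "\<forall>i<N. c i \<in> polys_below (Suc a)"
      using LE[OF s(1)] by blast
    obtain c' where c': "s' = (\<Sum>i<N. poly (c' i) x * v i)" "\<forall>i<N. c' i \<in> polys_below (Suc a)"
      using LE[OF s(2)] by blast
    have "s + s' = (\<Sum>i<N. poly (c i + c' i) x * v i)"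
      by (simp add: c c' sum.distrib distrib_right)
    also have "\<dots> \<in> L a"
      using c(2) c'(2) by (intro LI) (simp add: polys_below_def add_polys)
    finally show ?thesis .
  qed
  have L_zero: "0 \<in> L a" for a
    using LI[of "\<lambda>_. 0" a] by (simp add: polys_below_def zero_polys)
  have L_sum: "(\<Sum>i\<in>I. f i) \<in> L a" if "\<And>i. i \<in> I \<Longrightarrow> f i \<in> L a" for I :: "nat set" and f a
    using that by (induction I rule: infinite_finite_induct) (simp_all add: L_zero L_add)
  have L_w: "poly d x * w * s \<in> L (a + D)" if s: "s \<in> L a" for s a
  proof -
    obtain c where c: "s = (\<Sum>i<N. poly (c i) x * v i)" "\<forall>i<N. c i \<in> polys_below (Suc a)"
      using LE[OF s(1)] by blast
    have "poly d x * w * s = (\<Sum>j<N. poly (c j) x * (\<Sum>i<N. poly (r j i) x * v i))"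
      unfolding c(1) sum_distrib_left[of "poly d x * w"]
    proof (intro sum.cong refl)
      fix j assume "j \<in> {..<N}"
      have "poly d x * w * (poly (c j) x * v j) = poly (c j) x * (poly d x * (w * v j))"
        by (simp only: mult_ac)
      with \<open>j \<in> {..<N}\<close> show "poly d x * w * (poly (c j) x * v j) = poly (c j) x * (\<Sum>i<N. poly (r j i) x * v i)"
        by (simp add: wv)
    qed
    also have "\<dots> \<in> L (a + D)"
    proof (rule L_sum)
      fix j assume j: "j \<in> {..<N}"
      have "(\<Sum>i<N. poly (r j i) x * v i) \<in> L D" using r j by (intro LI) auto
      then have "poly (c j) x * (\<Sum>i<N. poly (r j i) x * v i) \<in> L (D + a)"
        using c(2) j by (intro L_mult) (auto simp: polys_below_Suc_iff)
      then show "poly (c j) x * (\<Sum>i<N. poly (r j i) x * v i) \<in> L (a + D)"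
        by (simp add: add.commute)
    qed
    finally show ?thesis .
  qed
  \<comment> \<open>The fixed factor d(x)^m clears each w^j with j at most m: j factors go with w^j
    and the others raise degrees only. So all terms of a polynomial in \<open>w\<close> land in the
    same space.\<close>
  have L_pow: "poly d x ^ e * ((poly d x * w) ^ j * s) \<in> L (a + (e + j) * D)" if s: "s \<in> L a" for s a e j
  proof -
    have 1: "(poly d x * w) ^ j * s \<in> L (a + j * D)"
    proof (induction j)
      case (Suc j)
      from L_w[OF this] show ?case by (simp add: algebra_simps)
    qed (simp add: s)
    show ?thesis
    proof (induction e)
      case (Suc e)
      from L_mult[OF this d(1,3)] show ?case by (simp add: algebra_simps)
    qed (simp add: 1)
  qed
  have fin_L: "finite (L a)" and card_L: "card (L a) \<le> card F ^ (N * Suc a)" for a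
  proof -
    let ?P = "PiE {..<N} (\<lambda>_. polys_below (Suc a))"
    have sub: "L a \<subseteq> (\<lambda>c. \<Sum>i<N. poly (c i) x * v i) ` ?P"
    proof
      fix s assume "s \<in> L a"
      then obtain c where c: "s = (\<Sum>i<N. poly (c i) x * v i)" "\<forall>i<N. c i \<in> polys_below (Suc a)"
        using LE by blast
      have "restrict c {..<N} \<in> ?P" using c(2) by auto
      then show "s \<in> (\<lambda>c. \<Sum>i<N. poly (c i) x * v i) ` ?P"
        by (rule rev_image_eqI) (simp add: c(1))
    qed
    show "finite (L a)" using finite_subset[OF sub] finite_PiE_polys_below by blast
    have "card (L a) \<le> card ?P"
      using card_mono[OF _ sub] card_image_le finite_PiE_polys_below by (meson finite_imageI order_trans)
    then show "card (L a) \<le> card F ^ (N * Suc a)" by (simp add: card_PiE_polys_below)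
  qed
  have bound: "k * Suc m \<le> N * Suc (a + m * D)"
    if indep: "indep w k u" and d': "d' \<in> polys" "d' \<noteq> 0" "\<And>i. i < k \<Longrightarrow> poly d' x * u i \<in> L a" for k u d' a m
  proof -
    let ?P = "PiE {..<k} (\<lambda>_. polys_below (Suc m))"
    define f where "f = (\<lambda>p. poly d x ^ m * poly d' x * (\<Sum>i<k. poly (p i) w * u i))"
    have dz: "poly d x ^ m * poly d' x \<noteq> 0" using transcD[OF transc_x] d d' by simp
    have "inj_on f ?P"
    proof (rule inj_onI)
      fix p q assume p: "p \<in> ?P" and q: "q \<in> ?P" and fpq: "f p = f q"
      have "(\<Sum>i<k. poly (p i) w * u i) = (\<Sum>i<k. poly (q i) w * u i)"
        using fpq unfolding f_def mult_left_cancel[OF dz] .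
      then have rel: "(\<Sum>i<k. poly (p i - q i) w * u i) = 0"
        by (simp add: left_diff_distrib sum_subtractf)
      have "p i = q i" if "i < k" for i
      proof -
        have "p i - q i = 0"
        proof (rule indepD[OF indep _ rel that])
          show "p i - q i \<in> polys" if "i < k" for i
            using PiE_mem[OF p, of i] PiE_mem[OF q, of i] that
            by (intro diff_polys polys_below_polys) simp_all
        qed
        then show ?thesis by simp
      qed
      then show "p = q" using p q by (intro PiE_ext) auto
    qed
    moreover have "f ` ?P \<subseteq> L (a + m * D)"
    proof
      fix y assume "y \<in> f ` ?P"
      then obtain p where p: "p \<in> ?P" "y = f p" by blast
      have "poly d x ^ m * (poly (p i) w * (poly d' x * u i)) \<in> L (a + m * D)" if i: "i < k" for i
      proof -
        have pi: "p i \<in> polys" "Polynomial.degree (p i) \<le> m"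
          using p i by (auto simp: polys_below_Suc_iff PiE_def Pi_def)
        have "poly (p i) w = (\<Sum>j\<le>m. Polynomial.coeff (p i) j * w ^ j)"
          unfolding poly_altdef using pi(2)
          by (intro sum.mono_neutral_left) (auto simp: coeff_eq_0)
        then have "poly d x ^ m * (poly (p i) w * (poly d' x * u i)) =
            (\<Sum>j\<le>m. poly d x ^ m * (Polynomial.coeff (p i) j * w ^ j * (poly d' x * u i)))"
          by (simp add: sum_distrib_left sum_distrib_right)
        also have "\<dots> \<in> L (a + m * D)"
        proof (rule L_sum)
          fix j assume "j \<in> {..m}"
          then have m: "m = (m - j) + j" by simp
          let ?c = "Polynomial.coeff (p i) j"
          have "poly [:?c:] x * (poly d x ^ (m - j) * ((poly d x * w) ^ j * (poly d' x * u i))) \<in>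
              L ((a + ((m - j) + j) * D) + 0)"
            using coeff_F[OF pi(1)] by (intro L_mult L_pow d'(3) i) (simp_all add: pCons_polys zero_polys)
          moreover have "poly d x ^ m = poly d x ^ (m - j) * poly d x ^ j"
            using m by (metis power_add)
          ultimately show "poly d x ^ m * (?c * w ^ j * (poly d' x * u i)) \<in> L (a + m * D)"
            unfolding m[symmetric] by (simp add: power_mult_distrib mult_ac)
        qed
        finally show ?thesis .
      qed
      then have "(\<Sum>i<k. poly d x ^ m * (poly (p i) w * (poly d' x * u i))) \<in> L (a + m * D)"
        by (intro L_sum) simp
      also have "(\<Sum>i<k. poly d x ^ m * (poly (p i) w * (poly d' x * u i))) = y"
        by (simp add: p(2) f_def sum_distrib_left mult_ac)
      finally show "y \<in> L (a + m * D)" .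
    qed
    ultimately have "card ?P \<le> card (L (a + m * D))"
      using card_inj_on_le fin_L by blast
    then have "card F ^ (k * Suc m) \<le> card F ^ (N * Suc (a + m * D))"
      using card_L[of "a + m * D"] unfolding card_PiE_polys_below by (rule order_trans)
    then show ?thesis using card_F by (simp add: power_increasing_iff)
  qed
  have "k \<le> N * D" if indep: "indep w k u" for k u
  proof (rule ccontr)
    assume "\<not> k \<le> N * D"
    then have k: "N * D + 1 \<le> k" by simp
    obtain d' c a where d': "d' \<in> polys" "d' \<noteq> 0"
      and c: "\<And>j i. j < k \<Longrightarrow> i < N \<Longrightarrow> c j i \<in> polys_below (Suc a)"
      and du: "\<And>j. j < k \<Longrightarrow> poly d' x * u j = (\<Sum>i<N. poly (c j i) x * v i)"
      using common_denominator[of k u] by blast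
    \<comment> \<open>Letting m grow in \<open>bound\<close> gives k at most N D; m = N (a + 1) is
      already large enough to refute k at least N D + 1.\<close>
    let ?m = "N * Suc a"
    have "k * Suc ?m \<le> N * Suc (a + ?m * D)"
    proof (rule bound[OF indep d'])
      show "poly d' x * u i \<in> L a" if "i < k" for i
        unfolding du[OF that] using c[OF that] by (rule LI)
    qed
    moreover have "(N * D + 1) * Suc ?m \<le> k * Suc ?m" using k by (rule mult_le_mono1)
    ultimately have "(N * D + 1) * Suc ?m \<le> N * Suc (a + ?m * D)" by (rule order_trans[rotated])
    then show False by (simp add: algebra_simps)
  qed
  then show ?thesis by blast
qed

section \<open>Valuation rings and their maximal ideals\<close>

lemma V_zero: "R \<in> V \<Longrightarrow> 0 \<in> R" and V_one: "R \<in> V \<Longrightarrow> 1 \<in> R"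
  by (simp_all add: V_F zero_F one_F)

lemma V_diff: "R \<in> V \<Longrightarrow> a \<in> R \<Longrightarrow> b \<in> R \<Longrightarrow> a - b \<in> R"
  using V_add[of R a "- b"] V_uminus[of R b] by simp

lemma V_power: "R \<in> V \<Longrightarrow> a \<in> R \<Longrightarrow> a ^ n \<in> R"
  by (induction n) (simp_all add: V_one V_mult)

lemma V_sum: "R \<in> V \<Longrightarrow> (\<And>i. i \<in> I \<Longrightarrow> f i \<in> R) \<Longrightarrow> sum f I \<in> R"
  by (induction I rule: infinite_finite_induct) (simp_all add: V_zero V_add)

lemma V_poly:
  assumes "R \<in> V" "p \<in> polys" "w \<in> R"
  shows "poly p w \<in> R"
  unfolding poly_altdef using assms
  by (intro V_sum V_mult V_power) (simp_all add: V_F coeff_F)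

text \<open>The nonunits. Zero has its own clause because \<open>inverse 0 = 0\<close> lies in
  \<open>R\<close>.\<close>

definition mx :: "'k set \<Rightarrow> 'k set" where
  "mx R = {z \<in> R. z = 0 \<or> inverse z \<notin> R}"

lemma mx_sub: "z \<in> mx R \<Longrightarrow> z \<in> R"
  by (simp add: mx_def)

lemma mx_mult: "R \<in> V \<Longrightarrow> a \<in> mx R \<Longrightarrow> r \<in> R \<Longrightarrow> r * a \<in> mx R"
proof -
  assume R: "R \<in> V" and a: "a \<in> mx R" and r: "r \<in> R"
  have "inverse (r * a) \<notin> R" if "r * a \<noteq> 0"
  proof
    assume "inverse (r * a) \<in> R"
    then have "r * inverse (r * a) \<in> R" using V_mult[OF R r] by blast
    moreover have "r * inverse (r * a) = inverse a" using that by (simp add: field_simps)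
    ultimately have "inverse a \<in> R" by (simp only:)
    then show False using a that by (simp add: mx_def)
  qed
  moreover have "r * a \<in> R" using V_mult[OF R r] a by (simp add: mx_def)
  ultimately show ?thesis by (auto simp: mx_def)
qed

lemma mx_one: "R \<in> V \<Longrightarrow> 1 \<notin> mx R"
  by (simp add: mx_def V_one)

text \<open>One of a / b and b / a lies in \<open>R\<close>, so the sum is an element of
  \<open>R\<close> times one of the summands.\<close>

lemma mx_add:
  assumes R: "R \<in> V" and a: "a \<in> mx R" and b: "b \<in> mx R"
  shows "a + b \<in> mx R"
proof (cases "a = 0 \<or> b = 0")
  case True
  then show ?thesis using a b by auto
next
  case False
  have *: "c + d \<in> mx R" if "c \<noteq> 0" "d \<noteq> 0" "d \<in> mx R" "c / d \<in> R" for c d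
  proof -
    have "1 + c / d \<in> R" using V_add[OF R V_one[OF R]] that by blast
    from mx_mult[OF R that(3) this] have "(1 + c / d) * d \<in> mx R" .
    moreover have "(1 + c / d) * d = c + d" using that by (simp add: distrib_right)
    ultimately show ?thesis by simp
  qed
  have "a / b \<in> R \<or> inverse (a / b) \<in> R" using V_total[OF R, of "a / b"] False by simp
  then show ?thesis
    using *[of a b] *[of b a] a b False by (auto simp: add.commute)
qed

lemma mx_uminus: "R \<in> V \<Longrightarrow> a \<in> mx R \<Longrightarrow> - a \<in> mx R"
  using mx_mult[of R a "- 1"] V_uminus[of R 1] V_one[of R] by simp

lemma mx_diff: "R \<in> V \<Longrightarrow> a \<in> mx R \<Longrightarrow> b \<in> mx R \<Longrightarrow> a - b \<in> mx R"
  using mx_add[of R a "- b"] mx_uminus[of R b] by simp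

lemma unit_inverse: "a \<in> R \<Longrightarrow> a \<notin> mx R \<Longrightarrow> a \<noteq> 0 \<and> inverse a \<in> R"
  by (auto simp: mx_def)

lemma mx_prime:
  assumes "R \<in> V" "a * b \<in> mx R" "a \<in> R" "b \<in> R" "a \<notin> mx R"
  shows "b \<in> mx R"
proof -
  have "inverse a * (a * b) \<in> mx R"
    using mx_mult[OF assms(1,2)] unit_inverse[OF assms(3,5)] by blast
  moreover have "inverse a * (a * b) = b"
    using unit_inverse[OF assms(3,5)] by simp
  ultimately show ?thesis by simp
qed

lemma mx_prime_power:
  assumes "R \<in> V" "a \<in> R" "a \<notin> mx R"
  shows "a ^ n \<notin> mx R"
proof (induction n)
  case (Suc n)
  show ?case
    using mx_prime[OF assms(1) _ assms(2) V_power[OF assms(1,2)] assms(3), of n] Suc by auto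
qed (simp add: mx_one assms)

lemma mx_F: "R \<in> V \<Longrightarrow> c \<in> F \<Longrightarrow> c \<in> mx R \<longleftrightarrow> c = 0"
  using V_F[of R "inverse c"] V_F[of R c] inverse_F[of c] by (auto simp: mx_def)

lemma mx_not_F:
  assumes "R \<in> V" "w \<in> mx R" "w \<noteq> 0"
  shows "w \<notin> F"
  using mx_F assms by blast

lemma poly_mod_mx:
  assumes "R \<in> V" "w \<in> mx R" "p \<in> polys"
  shows "poly p w - Polynomial.coeff p 0 \<in> mx R"
proof -
  obtain c q where q: "p = pCons c q" by (metis pCons_cases)
  then have "q \<in> polys" using assms(3) pCons_polys by blast
  then have "poly q w * w \<in> mx R"
    using mx_mult[OF assms(1,2)] V_poly[OF assms(1) _ mx_sub[OF assms(2)]] by blast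
  then show ?thesis by (simp add: q mult.commute)
qed

text \<open>Modulo the maximal ideal p(w) is the constant term of p, and nonzero constants are
  units.\<close>

lemma poly_unit:
  assumes "R \<in> V" "w \<in> mx R" "p \<in> polys" "Polynomial.coeff p 0 \<noteq> 0"
  shows "poly p w \<notin> mx R"
proof
  assume "poly p w \<in> mx R"
  then have "poly p w - (poly p w - Polynomial.coeff p 0) \<in> mx R"
    using poly_mod_mx[OF assms(1-3)] mx_diff[OF assms(1)] by blast
  then show False using mx_F[OF assms(1) coeff_F[OF assms(3)]] assms(4) by simp
qed

text \<open>By \<open>indep_bounded\<close> long lists of powers of z are dependent over F(w). Read
  backwards, \<open>indepI_constant_terms\<close> yields a relation whose coefficients are not all
  divisible by \<open>w\<close>, so that it remains nontrivial modulo a maximal ideal containing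
  \<open>w\<close>.\<close>

lemma relation:
  assumes "w \<notin> F"
  obtains p n where "\<And>i. p i \<in> polys" "(\<Sum>i\<le>n. poly (p i) w * z ^ i) = 0"
    "\<exists>i\<le>n. Polynomial.coeff (p i) 0 \<noteq> 0"
proof -
  obtain B where B: "\<And>k u. indep w k u \<Longrightarrow> k \<le> B" using indep_bounded by blast
  then have "\<not> indep w (Suc B) (\<lambda>i. z ^ i)" by fastforce
  moreover have "w \<noteq> 0" using assms zero_F by blast
  ultimately obtain p j where p: "\<And>i. i < Suc B \<Longrightarrow> p i \<in> polys"
    "(\<Sum>i<Suc B. poly (p i) w * z ^ i) = 0" "j < Suc B" "Polynomial.coeff (p j) 0 \<noteq> 0"
    using indepI_constant_terms[of w "Suc B" "\<lambda>i. z ^ i"] by blast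
  show thesis
  proof (rule that[of "\<lambda>i. if i < Suc B then p i else 0" B])
    show "(if i < Suc B then p i else 0) \<in> polys" for i using p(1) zero_polys by simp
    show "(\<Sum>i\<le>B. poly (if i < Suc B then p i else 0) w * z ^ i) = 0"
      using p(2) unfolding lessThan_Suc_atMost by simp
    show "\<exists>i\<le>B. Polynomial.coeff (if i < Suc B then p i else 0) 0 \<noteq> 0"
      using p(3,4) by (intro exI[of _ j]) simp
  qed
qed

text \<open>The partial sums of Horner's scheme at a root of a polynomial over a valuation ring lie in the
  ring: if \<open>z\<close> does not, then \<open>z\<inverse>\<close> does, and the complementary sum is a polynomial in \<open>z\<inverse>\<close>.\<close>

lemma horner_mem:
  assumes R: "R \<in> V" and a: "\<And>i. a i \<in> R" and root: "(\<Sum>i\<le>n. a i * z ^ i) = 0"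
  shows "(\<Sum>i=j..n. a i * z ^ (i - j)) \<in> R"
proof (cases "z \<in> R")
  case True
  then show ?thesis using a by (intro V_sum[OF R] V_mult[OF R] V_power[OF R])
next
  case False
  have z: "z \<noteq> 0" using False V_zero[OF R] by auto
  then have v: "inverse z \<in> R" using V_total[OF R z] False by blast
  show ?thesis
  proof (cases "j \<le> n")
    case True
    have "{..n} = {..<j} \<union> {j..n}" using True by auto
    then have "(\<Sum>i\<le>n. a i * z ^ i) = (\<Sum>i<j. a i * z ^ i) + (\<Sum>i=j..n. a i * z ^ i)"
      by (simp only:) (rule sum.union_disjoint, simp_all add: disjoint_iff)
    then have 1: "(\<Sum>i=j..n. a i * z ^ i) = - (\<Sum>i<j. a i * z ^ i)"
      unfolding root by (simp add: eq_neg_iff_add_eq_0 add.commute)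
    have "(\<Sum>i=j..n. a i * z ^ (i - j)) = inverse z ^ j * (\<Sum>i=j..n. a i * z ^ i)"
      unfolding sum_distrib_left
    proof (rule sum.cong[OF refl])
      fix i assume "i \<in> {j..n}"
      then have "z ^ i = z ^ (i - j) * z ^ j" by (simp flip: power_add)
      then show "a i * z ^ (i - j) = inverse z ^ j * (a i * z ^ i)"
        using z by (simp add: power_inverse)
    qed
    also have "\<dots> = - (\<Sum>i<j. a i * inverse z ^ (j - i))"
      unfolding 1 mult_minus_right sum_distrib_left
    proof (intro arg_cong[of _ _ uminus] sum.cong refl)
      fix i assume "i \<in> {..<j}"
      then have "inverse z ^ j = inverse z ^ (j - i) * inverse z ^ i" by (simp flip: power_add)
      then show "inverse z ^ j * (a i * z ^ i) = a i * inverse z ^ (j - i)"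
        using z by (simp add: power_inverse)
    qed
    also have "\<dots> \<in> R"
      using a v by (intro V_uminus[OF R] V_sum[OF R] V_mult[OF R] V_power[OF R])
    finally show ?thesis .
  next
    case False
    then show ?thesis by (simp add: V_zero[OF R])
  qed
qed

lemma horner_step:
  fixes z :: 'k
  assumes "j \<le> n"
  shows "(\<Sum>i=j..n. a i * z ^ (i - j)) = a j + z * (\<Sum>i=Suc j..n. a i * z ^ (i - Suc j))"
proof -
  have "(\<Sum>i=j..n. a i * z ^ (i - j)) = a j + (\<Sum>i=Suc j..n. a i * z ^ (i - j))"
    using assms by (simp add: sum.atLeast_Suc_atMost)
  also have "(\<Sum>i=Suc j..n. a i * z ^ (i - j)) = z * (\<Sum>i=Suc j..n. a i * z ^ (i - Suc j))"
    unfolding sum_distrib_left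
  proof (rule sum.cong[OF refl])
    fix i assume "i \<in> {Suc j..n}"
    then have "i - j = Suc (i - Suc j)" by auto
    then show "a i * z ^ (i - j) = z * (a i * z ^ (i - Suc j))" by simp
  qed
  finally show ?thesis .
qed

text \<open>For a relation with leading coefficient p_n, the Horner sum p_{n-1}(w) + p_n(w) z lies
  in every \<open>R\<close> containing \<open>w\<close>, and therefore so does p_n(w) z. The same
  \<open>d\<close> works for all these \<open>R\<close>.\<close>

lemma clear_denominator:
  assumes "w \<notin> F"
  obtains d where "d \<in> polys" "d \<noteq> 0" "\<And>R. R \<in> V \<Longrightarrow> w \<in> R \<Longrightarrow> poly d w * z \<in> R"
proof -
  obtain p m where p: "\<And>i. p i \<in> polys" "(\<Sum>i\<le>m. poly (p i) w * z ^ i) = 0"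
    and ex: "\<exists>i\<le>m. Polynomial.coeff (p i) 0 \<noteq> 0"
    using relation[OF assms, where z = z] by blast
  define n where "n = Max {i. i \<le> m \<and> p i \<noteq> 0}"
  have fin: "finite {i. i \<le> m \<and> p i \<noteq> 0}" by simp
  have "{i. i \<le> m \<and> p i \<noteq> 0} \<noteq> {}" using ex by force
  from Max_in[OF fin this] have n: "n \<le> m" "p n \<noteq> 0" by (auto simp: n_def)
  have zero: "p i = 0" if "n < i" "i \<le> m" for i
  proof (rule ccontr)
    assume "p i \<noteq> 0"
    then have "i \<le> n" unfolding n_def using that(2) by (intro Max_ge[OF fin]) simp
    then show False using that(1) by simp
  qed
  have "(\<Sum>i\<le>m. poly (p i) w * z ^ i) = (\<Sum>i\<le>n. poly (p i) w * z ^ i)"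
    using n(1) zero by (intro sum.mono_neutral_right) auto
  then have root: "(\<Sum>i\<le>n. poly (p i) w * z ^ i) = 0" using p(2) by simp
  show thesis
  proof (rule that[of "p n"])
    show "p n \<in> polys" "p n \<noteq> 0" using p n by auto
    fix R assume R: "R \<in> V" "w \<in> R"
    have pw: "poly (p i) w \<in> R" for i using V_poly[OF R(1) p(1) R(2)] .
    have "n \<noteq> 0"
    proof
      assume "n = 0"
      then have "poly (p n) w = 0" using root by simp
      then show False using transcD[OF transc[OF assms] p(1) n(2)] by blast
    qed
    then obtain k where k: "n = Suc k" by (metis not0_implies_Suc)
    have "(\<Sum>i=k..n. poly (p i) w * z ^ (i - k)) - poly (p k) w \<in> R"
      by (intro V_diff[OF R(1)] pw horner_mem[OF R(1) pw root])
    then show "poly (p n) w * z \<in> R"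
      by (simp add: k mult.commute)
  qed
qed

end

section \<open>A nonconstant function with a single pole\<close>

locale function_field_place = function_field F V x N v
  for F :: "'k::field set" and V x N v +
  fixes Rinf :: "'k set" and w :: 'k
  assumes Rinf: "Rinf \<in> V" and w_mx: "w \<in> mx Rinf" and w_nz: "w \<noteq> 0"
begin

lemma w_not_F: "w \<notin> F"
  using Rinf w_mx w_nz by (rule mx_not_F)

text \<open>\<open>S\<close> is the integral closure of the localization of \<open>F[w]\<close> at \<open>w\<close>.\<close>

definition S :: "'k set" where
  "S = {z. \<forall>R\<in>V. w \<in> mx R \<longrightarrow> z \<in> R}"

lemma S_I: "(\<And>R. R \<in> V \<Longrightarrow> w \<in> mx R \<Longrightarrow> z \<in> R) \<Longrightarrow> z \<in> S"
  by (simp add: S_def)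

lemma S_D: "z \<in> S \<Longrightarrow> R \<in> V \<Longrightarrow> w \<in> mx R \<Longrightarrow> z \<in> R"
  by (simp add: S_def)

lemma S_add: "a \<in> S \<Longrightarrow> b \<in> S \<Longrightarrow> a + b \<in> S"
  and S_diff: "a \<in> S \<Longrightarrow> b \<in> S \<Longrightarrow> a - b \<in> S"
  and S_mult: "a \<in> S \<Longrightarrow> b \<in> S \<Longrightarrow> a * b \<in> S"
  and S_uminus: "a \<in> S \<Longrightarrow> - a \<in> S"
  and S_F: "c \<in> F \<Longrightarrow> c \<in> S"
  and S_w: "w \<in> S"
  by (simp_all add: S_def V_add V_diff V_mult V_uminus V_F mx_sub)

lemma S_power: "a \<in> S \<Longrightarrow> a ^ n \<in> S"
  by (induction n) (simp_all add: S_mult S_F one_F)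

lemma S_sum: "(\<And>i. i \<in> I \<Longrightarrow> f i \<in> S) \<Longrightarrow> sum f I \<in> S"
  by (induction I rule: infinite_finite_induct) (simp_all add: S_add S_F zero_F)

lemma S_poly: "p \<in> polys \<Longrightarrow> poly p w \<in> S"
  by (intro S_I V_poly) (simp_all add: mx_sub)

lemma S_inverse_poly:
  assumes "p \<in> polys" "Polynomial.coeff p 0 \<noteq> 0"
  shows "inverse (poly p w) \<in> S"
proof (rule S_I)
  fix R assume R: "R \<in> V" "w \<in> mx R"
  show "inverse (poly p w) \<in> R"
    using unit_inverse[OF V_poly[OF R(1) assms(1) mx_sub[OF R(2)]] poly_unit[OF R assms]] by blast
qed

text \<open>Of a denominator in F[w] only the power of \<open>w\<close> matters: the cofactor with
  nonzero constant term is a unit of \<open>S\<close>.\<close>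

lemma power_mult_S: "\<exists>c. w ^ c * z \<in> S"
proof -
  obtain d where d: "d \<in> polys" "d \<noteq> 0" "\<And>R. R \<in> V \<Longrightarrow> w \<in> R \<Longrightarrow> poly d w * z \<in> R"
    using clear_denominator[OF w_not_F, where z = z] by blast
  obtain c g where g: "g \<in> polys" "Polynomial.coeff g 0 \<noteq> 0" "d = Polynomial.monom 1 c * g"
    using split_X_power[OF d(1,2)] by blast
  have "poly g w \<noteq> 0"
    using transcD[OF transc[OF w_not_F] g(1)] g(2) by force
  then have "w ^ c * z = inverse (poly g w) * (poly d w * z)"
    by (simp add: g(3) poly_monom field_simps)
  also have "\<dots> \<in> S"
    using d(3) by (intro S_mult S_inverse_poly[OF g(1,2)] S_I) (simp add: mx_sub)
  finally show ?thesis by blast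
qed

section \<open>The F-dimension of S / wS and residues modulo powers of w\<close>

definition residually_indep :: "nat \<Rightarrow> (nat \<Rightarrow> 'k) \<Rightarrow> bool" where
  "residually_indep k t \<longleftrightarrow> (\<forall>i<k. t i \<in> S) \<and>
    (\<forall>c. (\<forall>i<k. c i \<in> F) \<longrightarrow> (\<exists>s\<in>S. (\<Sum>i<k. c i * t i) = w * s) \<longrightarrow> (\<forall>i<k. c i = 0))"

text \<open>The constant terms of a relation over F[w] form a relation in S / wS and so vanish,
  which is what \<open>indepI_constant_terms\<close> asks for. Hence the dimension of S / wS is at
  most [K : F(w)].\<close>

lemma residually_indep_imp_indep:
  assumes "residually_indep k t"
  shows "indep w k t"
proof (rule indepI_constant_terms[OF w_nz])
  fix p i
  assume p: "\<And>i. i < k \<Longrightarrow> p i \<in> polys" and rel: "(\<Sum>i<k. poly (p i) w * t i) = 0" and i: "i < k"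
  have t: "t j \<in> S" if "j < k" for j using assms that by (simp add: residually_indep_def)
  have "\<exists>a q. p j = pCons a q" for j by (metis pCons_cases)
  then obtain a q where q: "\<And>j. p j = pCons (a j) (q j)" by metis
  have aq: "a j \<in> F" "q j \<in> polys" if "j < k" for j
    using p[OF that] pCons_polys q[of j] by simp_all
  have "(\<Sum>j<k. a j * t j) + w * (\<Sum>j<k. poly (q j) w * t j) = (\<Sum>j<k. poly (p j) w * t j)"
    by (simp add: q sum_distrib_left sum.distrib algebra_simps)
  then have "(\<Sum>j<k. a j * t j) = w * - (\<Sum>j<k. poly (q j) w * t j)"
    unfolding rel by (simp add: eq_neg_iff_add_eq_0)
  moreover have "- (\<Sum>j<k. poly (q j) w * t j) \<in> S"
    using aq t by (intro S_uminus S_sum S_mult S_poly) simp_all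
  ultimately have "\<exists>s\<in>S. (\<Sum>j<k. a j * t j) = w * s" by blast
  then have "a i = 0"
    using assms aq i unfolding residually_indep_def by blast
  then show "Polynomial.coeff (p i) 0 = 0" by (simp add: q)
qed

definition field_degree :: nat where
  "field_degree = (GREATEST k. \<exists>u. indep w k u)"

lemma field_degree_le: "indep w k u \<Longrightarrow> k \<le> field_degree"
  unfolding field_degree_def using indep_bounded[of w] Greatest_le_nat[of "\<lambda>k. \<exists>u. indep w k u" k] by blast

lemma field_degree_attained: "\<exists>u. indep w field_degree u"
proof -
  have "\<exists>u. indep w 0 u" by (simp add: indep_def)
  then show ?thesis
    unfolding field_degree_def using indep_bounded[of w] GreatestI_nat[of "\<lambda>k. \<exists>u. indep w k u" 0] by blast
qed

text \<open>A maximal family that is independent in S / wS spans it: the relation created by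
  adjoining s has a nonzero coefficient at s and can be solved for s.\<close>

lemma residual_generators:
  obtains k t where "k \<le> field_degree" "\<And>i. i < k \<Longrightarrow> t i \<in> S"
    "\<And>s. s \<in> S \<Longrightarrow> \<exists>c s'. (\<forall>i<k. c i \<in> F) \<and> s' \<in> S \<and> s = (\<Sum>i<k. c i * t i) + w * s'"
proof -
  let ?P = "\<lambda>k. \<exists>t. residually_indep k t"
  have le: "k \<le> field_degree" if "?P k" for k
    using that residually_indep_imp_indep field_degree_le by blast
  have "?P 0" by (simp add: residually_indep_def)
  then obtain k where k: "?P k" "\<And>k'. ?P k' \<Longrightarrow> k' \<le> k"
    using GreatestI_nat[of ?P 0 field_degree] Greatest_le_nat[of ?P _ field_degree] le by blast
  then obtain t where t: "residually_indep k t" by blast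
  have tS: "t i \<in> S" if "i < k" for i using t that by (simp add: residually_indep_def)
  have "\<exists>c s'. (\<forall>i<k. c i \<in> F) \<and> s' \<in> S \<and> s = (\<Sum>i<k. c i * t i) + w * s'" if s: "s \<in> S" for s
  proof -
    let ?t = "t(k := s)"
    have "\<not> residually_indep (Suc k) ?t" using k(2)[of "Suc k"] by auto
    moreover have "\<forall>i<Suc k. ?t i \<in> S" using tS s by (simp add: less_Suc_eq)
    ultimately obtain c r where c: "\<forall>i<Suc k. c i \<in> F" and r: "r \<in> S" "(\<Sum>i<Suc k. c i * ?t i) = w * r"
      and nz: "\<not> (\<forall>i<Suc k. c i = 0)"
      unfolding residually_indep_def by blast
    have sum: "(\<Sum>i<k. c i * t i) + c k * s = w * r"
    proof -
      have "(\<Sum>i<k. c i * ?t i) = (\<Sum>i<k. c i * t i)" by (rule sum.cong) simp_all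
      then show ?thesis using r(2) by simp
    qed
    have ck: "c k \<noteq> 0"
    proof
      assume 0: "c k = 0"
      then have "\<exists>s\<in>S. (\<Sum>i<k. c i * t i) = w * s" using sum r(1) by auto
      moreover have "\<forall>i<k. c i \<in> F" using c by simp
      ultimately have "\<forall>i<k. c i = 0" using t unfolding residually_indep_def by blast
      then show False using nz 0 by (simp add: less_Suc_eq)
    qed
    let ?i = "inverse (c k)"
    have i: "?i \<in> F" using c by (simp add: inverse_F)
    have "s = ?i * (c k * s)" using ck by simp
    also have "c k * s = - (\<Sum>i<k. c i * t i) + w * r" using sum by (simp add: eq_diff_eq algebra_simps)
    also have "?i * \<dots> = (\<Sum>i<k. (- ?i * c i) * t i) + w * (?i * r)"
      by (simp add: sum_distrib_left sum_negf algebra_simps)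
    finally have "s = (\<Sum>i<k. (- ?i * c i) * t i) + w * (?i * r)" .
    moreover have "\<forall>j<k. - ?i * c j \<in> F" using c i by (simp add: mult_F uminus_F)
    moreover have "?i * r \<in> S" using S_mult[OF S_F[OF i] r(1)] .
    ultimately show ?thesis by (intro exI[of _ "\<lambda>j. - ?i * c j"] exI[of _ "?i * r"] conjI)
  qed
  then show thesis using le[OF k(1)] tS that by blast
qed

text \<open>Iterating \<open>residual_generators\<close> gives a w-adic expansion of s with m digits
  for each generator. The map \<open>r\<close> records these digits as polynomials and stands in for
  the projection to S / w^m S.\<close>

lemma residues:
  obtains T and r :: "'k \<Rightarrow> nat \<Rightarrow> 'k poly" where "finite T" "card T \<le> card F ^ (field_degree * m)" "r ` S \<subseteq> T"
    "\<And>s s'. s \<in> S \<Longrightarrow> s' \<in> S \<Longrightarrow> r s = r s' \<Longrightarrow> \<exists>z\<in>S. s - s' = w ^ m * z"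
proof -
  obtain k t where k: "k \<le> field_degree" and tS: "\<And>i. i < k \<Longrightarrow> t i \<in> S" and
    gen: "\<And>s. s \<in> S \<Longrightarrow> \<exists>c s'. (\<forall>i<k. c i \<in> F) \<and> s' \<in> S \<and> s = (\<Sum>i<k. c i * t i) + w * s'"
    using residual_generators by blast
  have ex: "\<exists>p s'. (\<forall>i<k. p i \<in> polys_below m) \<and> s' \<in> S \<and> s = (\<Sum>i<k. poly (p i) w * t i) + w ^ m * s'"
    if "s \<in> S" for s
    using that
  proof (induction m arbitrary: s)
    case 0
    then show ?case by (intro exI[of _ "\<lambda>_. 0"] exI[of _ s]) (simp add: polys_below_0)
  next
    case (Suc m)
    obtain c s1 where c: "\<forall>i<k. c i \<in> F" "s1 \<in> S" "s = (\<Sum>i<k. c i * t i) + w * s1"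
      using gen[OF Suc.prems] by blast
    obtain p s2 where p: "\<forall>i<k. p i \<in> polys_below m" "s2 \<in> S" "s1 = (\<Sum>i<k. poly (p i) w * t i) + w ^ m * s2"
      using Suc.IH[OF c(2)] by blast
    have "s = (\<Sum>i<k. poly (pCons (c i) (p i)) w * t i) + w ^ Suc m * s2"
      unfolding c(3) p(3) by (simp add: sum.distrib sum_distrib_left algebra_simps)
    moreover have "\<forall>i<k. pCons (c i) (p i) \<in> polys_below (Suc m)"
      using c(1) p(1) by (simp add: pCons_polys_below)
    ultimately show ?case using p(2) by (intro exI[of _ "\<lambda>i. pCons (c i) (p i)"] exI[of _ s2] conjI)
  qed
  let ?Q = "\<lambda>s p. p \<in> PiE {..<k} (\<lambda>_. polys_below m) \<and>
      (\<exists>s'\<in>S. s = (\<Sum>i<k. poly (p i) w * t i) + w ^ m * s')"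
  define r where "r = (\<lambda>s. SOME p. ?Q s p)"
  have r: "?Q s (r s)" if s: "s \<in> S" for s
  proof -
    obtain p s' where p: "\<forall>i<k. p i \<in> polys_below m" "s' \<in> S" "s = (\<Sum>i<k. poly (p i) w * t i) + w ^ m * s'"
      using ex[OF s] by blast
    have "?Q s (restrict p {..<k})"
      using p by (intro conjI bexI[of _ s']) simp_all
    then show ?thesis unfolding r_def by (rule someI[of "?Q s"])
  qed
  show thesis
  proof (rule that[of "PiE {..<k} (\<lambda>_. polys_below m)" r])
    show "finite (PiE {..<k} (\<lambda>_. polys_below m))" by (rule finite_PiE_polys_below)
    show "card (PiE {..<k} (\<lambda>_. polys_below m)) \<le> card F ^ (field_degree * m)"
      using k card_F by (simp add: card_PiE_polys_below power_increasing)
    show "r ` S \<subseteq> PiE {..<k} (\<lambda>_. polys_below m)" using r by blast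
    fix s s' assume s: "s \<in> S" "s' \<in> S" "r s = r s'"
    obtain z where z: "z \<in> S" "s = (\<Sum>i<k. poly (r s i) w * t i) + w ^ m * z" using r[OF s(1)] by blast
    obtain z' where z': "z' \<in> S" "s' = (\<Sum>i<k. poly (r s i) w * t i) + w ^ m * z'" using r[OF s(2)] s(3) by auto
    have "s - s' = w ^ m * (z - z')" by (subst z(2), subst z'(2)) (simp add: right_diff_distrib)
    then show "\<exists>z\<in>S. s - s' = w ^ m * z" using z(1) z'(1) S_diff by blast
  qed
qed

text \<open>In the finite ring S / wS two powers of b agree. This replaces orders of vanishing
  twice: it makes centers maximal in \<open>centers_determine\<close> and yields divisibility by
  \<open>w\<close> in \<open>separating_element\<close>.\<close>

lemma power_recurs:
  assumes "b \<in> S"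
  obtains i d z where "d \<ge> 1" "z \<in> S" "b ^ i * (1 - b ^ d) = w * z"
proof -
  obtain T and r :: "'k \<Rightarrow> nat \<Rightarrow> 'k poly" where T: "finite T" "r ` S \<subseteq> T"
    and r: "\<And>s s'. s \<in> S \<Longrightarrow> s' \<in> S \<Longrightarrow> r s = r s' \<Longrightarrow> \<exists>z\<in>S. s - s' = w ^ 1 * z"
    using residues[of 1] by metis
  have "range (\<lambda>n::nat. r (b ^ n)) \<subseteq> T" using T(2) S_power[OF assms] by blast
  then have "finite (range (\<lambda>n::nat. r (b ^ n)))" using T(1) finite_subset by blast
  then have "\<not> inj (\<lambda>n::nat. r (b ^ n))" using finite_imageD infinite_UNIV_nat by blast
  then obtain i j :: nat where ij: "i < j" "r (b ^ i) = r (b ^ j)"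
    unfolding inj_on_def by (metis linorder_neqE_nat)
  obtain z where z: "z \<in> S" "b ^ i - b ^ j = w ^ 1 * z"
    using r[OF S_power[OF assms] S_power[OF assms] ij(2)] by blast
  have "b ^ j = b ^ i * b ^ (j - i)" using ij(1) by (simp flip: power_add)
  then have "b ^ i * (1 - b ^ (j - i)) = w * z" using z(2) by (simp add: right_diff_distrib)
  then show thesis using that[of "j - i" z i] ij(1) z(1) by simp
qed

text \<open>If all Horner sums of a primitive relation for \<open>z\<close> were nonunits, so would be all its coefficients.\<close>

lemma localization:
  assumes R: "R \<in> V" "w \<in> mx R" and z: "z \<in> R"
  obtains b where "b \<in> S" "b \<notin> mx R" "z * b \<in> S"
proof -
  obtain p n where p: "\<And>i. p i \<in> polys" and root: "(\<Sum>i\<le>n. poly (p i) w * z ^ i) = 0"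
    and ex: "\<exists>i\<le>n. Polynomial.coeff (p i) 0 \<noteq> 0"
    using relation[OF w_not_F, where z = z] by blast
  define b where "b = (\<lambda>j. \<Sum>i=j..n. poly (p i) w * z ^ (i - j))"
  have pS: "poly (p i) w \<in> S" for i using p by (rule S_poly)
  have bS: "b j \<in> S" for j
    unfolding b_def
  proof (rule S_I)
    fix R' assume R': "R' \<in> V" "w \<in> mx R'"
    show "(\<Sum>i=j..n. poly (p i) w * z ^ (i - j)) \<in> R'"
      using S_D[OF pS R'] by (rule horner_mem[OF R'(1) _ root])
  qed
  have b0: "b 0 = 0" using root by (simp add: b_def atMost_atLeast0)
  have step: "b j = poly (p j) w + z * b (Suc j)" if "j \<le> n" for j
    unfolding b_def by (rule horner_step[OF that])
  have "\<exists>j\<le>n. b (Suc j) \<notin> mx R"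
  proof (rule ccontr)
    assume "\<not> ?thesis"
    then have mx: "b (Suc j) \<in> mx R" if "j \<le> n" for j using that by auto
    obtain j where j: "j \<le> n" "Polynomial.coeff (p j) 0 \<noteq> 0" using ex by blast
    \<comment> \<open>For j = 0 this is the relation itself, \<open>b 0 = 0\<close>; otherwise it is
      the assumption at j - 1.\<close>
    have "b j \<in> mx R"
      using mx[of "j - 1"] j(1) b0 mx_def[of R] V_zero[OF R(1)] by (cases j) auto
    then have "b j - z * b (Suc j) \<in> mx R"
      by (rule mx_diff[OF R(1) _ mx_mult[OF R(1) mx[OF j(1)] z]])
    moreover have "b j - z * b (Suc j) = poly (p j) w" using step[OF j(1)] by simp
    ultimately show False using poly_unit[OF R p j(2)] by simp
  qed
  then obtain j where j: "j \<le> n" "b (Suc j) \<notin> mx R" by blast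
  have "z * b (Suc j) = b j - poly (p j) w" using step[OF j(1)] by simp
  also have "\<dots> \<in> S" by (intro S_diff bS pS)
  finally show thesis using that[OF bS j(2)] by blast
qed

text \<open>The prime S \<inter> mx R contains \<open>w\<close>, and S / wS is finite, so it is
  maximal, as a finite domain is a field; hence one inclusion forces equality. By
  \<open>localization\<close>, R consists of fractions over \<open>S\<close> with denominators
  outside its center.\<close>

lemma centers_determine:
  assumes R: "R \<in> V" "w \<in> mx R" and R': "R' \<in> V" "w \<in> mx R'"
    and sub: "S \<inter> mx R' \<subseteq> mx R"
  shows "R = R'"
proof -
  have sub': "S \<inter> mx R \<subseteq> mx R'"
  proof
    fix b assume "b \<in> S \<inter> mx R"
    then have b: "b \<in> S" "b \<in> mx R" by auto
    show "b \<in> mx R'"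
    proof (rule ccontr)
      assume not: "b \<notin> mx R'"
      obtain i d z where z: "d \<ge> 1" "z \<in> S" "b ^ i * (1 - b ^ d) = w * z"
        using power_recurs[OF b(1)] by blast
      have bR': "b \<in> R'" by (rule S_D[OF b(1) R'])
      have u: "1 - b ^ d \<in> S" by (intro S_diff S_power b(1) S_F one_F)
      have "z * w \<in> mx R'" by (rule mx_mult[OF R' S_D[OF z(2) R']])
      then have "b ^ i * (1 - b ^ d) \<in> mx R'" unfolding z(3) by (simp add: mult.commute)
      then have "1 - b ^ d \<in> mx R'"
        by (rule mx_prime[OF R'(1) _ V_power[OF R'(1) bR'] S_D[OF u R'] mx_prime_power[OF R'(1) bR' not]])
      \<comment> \<open>Together with b^d this puts 1 into the maximal ideal of
        \<open>R\<close>.\<close>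
      then have "1 - b ^ d \<in> mx R" using sub u by blast
      moreover have "b ^ (d - 1) * b \<in> mx R"
        by (rule mx_mult[OF R(1) b(2) V_power[OF R(1) S_D[OF b(1) R]]])
      then have "b ^ d \<in> mx R" using z(1) by (cases d) (simp_all add: mult.commute)
      ultimately have "1 - b ^ d + b ^ d \<in> mx R" by (rule mx_add[OF R(1)])
      then show False using mx_one[OF R(1)] by simp
    qed
  qed
  have incl: "Q' \<subseteq> Q" if Q: "Q \<in> V" "w \<in> mx Q" "Q' \<in> V" "w \<in> mx Q'" and s: "S \<inter> mx Q \<subseteq> mx Q'" for Q Q'
  proof
    fix z assume z: "z \<in> Q'"
    obtain b where b: "b \<in> S" "b \<notin> mx Q'" "z * b \<in> S" using localization[OF Q(3,4) z] by blast
    then have "b \<notin> mx Q" using s by blast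
    then have i: "b \<noteq> 0" "inverse b \<in> Q" using unit_inverse[OF S_D[OF b(1) Q(1,2)]] by auto
    have "(z * b) * inverse b \<in> Q" by (rule V_mult[OF Q(1) S_D[OF b(3) Q(1,2)] i(2)])
    moreover have "(z * b) * inverse b = z" using i(1) by (simp add: mult.assoc)
    ultimately show "z \<in> Q" by (simp only:)
  qed
  show ?thesis using incl[OF R R' sub'] incl[OF R' R sub] by (rule equalityI[rotated])
qed

text \<open>Each \<open>S \<inter> mx R\<close> is a union of cosets of \<open>wS\<close>, and \<open>S / wS\<close> is finite.\<close>

lemma finite_centers: "finite ((\<lambda>R. S \<inter> mx R) ` {R \<in> V. w \<in> mx R})"
proof -
  let ?I = "(\<lambda>R. S \<inter> mx R) ` {R \<in> V. w \<in> mx R}"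
  obtain T and r :: "'k \<Rightarrow> nat \<Rightarrow> 'k poly" where T: "finite T" "r ` S \<subseteq> T"
    and r: "\<And>s s'. s \<in> S \<Longrightarrow> s' \<in> S \<Longrightarrow> r s = r s' \<Longrightarrow> \<exists>z\<in>S. s - s' = w ^ 1 * z"
    using residues[of 1] by metis
  have recover: "I = {s \<in> S. r s \<in> r ` I}" if center: "I \<in> ?I" for I
  proof -
    obtain R where R: "R \<in> V" "w \<in> mx R" and I: "I = S \<inter> mx R" using center by blast
    have "s \<in> mx R" if s: "s \<in> S" and s': "s' \<in> S" "s' \<in> mx R" "r s = r s'" for s s'
    proof -
      obtain z where z: "z \<in> S" "s - s' = w ^ 1 * z" using r[OF s s'(1,3)] by blast
      have "z * w \<in> mx R" by (rule mx_mult[OF R S_D[OF z(1) R]])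
      then have "s - s' \<in> mx R" using z(2) by (simp add: mult.commute)
      from mx_add[OF R(1) this s'(2)] show ?thesis by simp
    qed
    then show ?thesis unfolding I by auto
  qed
  have "inj_on (\<lambda>I. r ` I) ?I"
  proof (rule inj_onI)
    fix I J assume IJ: "I \<in> ?I" "J \<in> ?I" "r ` I = r ` J"
    show "I = J" using recover[OF IJ(1)] recover[OF IJ(2)] unfolding IJ(3) by simp
  qed
  moreover have "(\<lambda>I. r ` I) ` ?I \<subseteq> Pow T" using T(2) by auto
  moreover have "finite (Pow T)" using T(1) by simp
  ultimately show ?thesis by (rule inj_on_finite)
qed

text \<open>Prime avoidance: the product of one witness per other center vanishes at all other
  places above \<open>w\<close> but not at \<open>Rinf\<close>. Vanishing is then strengthened to
  divisibility by \<open>w\<close>: from a^i (1 - a^d) = w z one gets a^i / w = z / (1 - a^d), whose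
  denominator is a unit wherever a vanishes.\<close>

lemma separating_element:
  obtains a where "a \<in> S" "a \<notin> mx Rinf"
    "\<And>R. R \<in> V \<Longrightarrow> w \<in> mx R \<Longrightarrow> R \<noteq> Rinf \<Longrightarrow> a / w \<in> R"
proof -
  define Is where "Is = (\<lambda>R. S \<inter> mx R) ` {R \<in> V. w \<in> mx R} - {S \<inter> mx Rinf}"
  have "\<exists>b. b \<in> I \<and> b \<notin> mx Rinf" if I: "I \<in> Is" for I
  proof -
    obtain R where R: "R \<in> V" "w \<in> mx R" "I = S \<inter> mx R" "I \<noteq> S \<inter> mx Rinf"
      using I unfolding Is_def by blast
    have "\<not> S \<inter> mx R \<subseteq> mx Rinf"
      using centers_determine[OF Rinf w_mx R(1,2)] R(3,4) by blast
    then show ?thesis using R(3) by blast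
  qed
  then obtain b where b: "\<And>I. I \<in> Is \<Longrightarrow> b I \<in> I" "\<And>I. I \<in> Is \<Longrightarrow> b I \<notin> mx Rinf" by metis
  have bS: "b I \<in> S" if "I \<in> Is" for I
    using b(1)[OF that] that unfolding Is_def by blast
  have fin: "finite Is" unfolding Is_def using finite_centers by simp
  have prod_S: "prod b J \<in> S" if "J \<subseteq> Is" for J
    using finite_subset[OF that fin] that by (induction J rule: finite_induct) (simp_all add: S_F one_F S_mult bS)
  have prod_not: "prod b J \<notin> mx Rinf" if "J \<subseteq> Is" for J
    using finite_subset[OF that fin] that
  proof (induction J rule: finite_induct)
    case (insert I J)
    show ?case
    proof
      assume "prod b (insert I J) \<in> mx Rinf"
      then have "b I * prod b J \<in> mx Rinf" using insert.hyps by simp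
      moreover have "I \<in> Is" "J \<subseteq> Is" using insert.prems by simp_all
      ultimately have "prod b J \<in> mx Rinf"
        using mx_prime[OF Rinf _ S_D[OF bS Rinf w_mx] S_D[OF prod_S Rinf w_mx] b(2)] by blast
      then show False using insert by simp
    qed
  qed (simp add: mx_one Rinf)
  define a where "a = prod b Is"
  have aS: "a \<in> S" and a_not: "a \<notin> mx Rinf" unfolding a_def using prod_S prod_not by simp_all
  have a_mx: "a \<in> mx R" if R: "R \<in> V" "w \<in> mx R" "R \<noteq> Rinf" for R
  proof -
    let ?I = "S \<inter> mx R"
    have "?I \<noteq> S \<inter> mx Rinf" using centers_determine[OF Rinf w_mx R(1,2)] R(3) by blast
    then have I: "?I \<in> Is" unfolding Is_def using R by blast
    have "a = prod b (Is - {?I}) * b ?I"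
      unfolding a_def using prod.remove[OF fin I, of b] by (simp add: mult.commute)
    moreover have "prod b (Is - {?I}) \<in> R" using prod_S[of "Is - {?I}"] S_D[OF _ R(1,2)] by blast
    ultimately show ?thesis using mx_mult[OF R(1)] b(1)[OF I] by simp
  qed
  obtain i d z where z: "d \<ge> 1" "z \<in> S" "a ^ i * (1 - a ^ d) = w * z"
    using power_recurs[OF aS] by blast
  show thesis
  proof (rule that[of "a ^ i"])
    show "a ^ i \<in> S" by (rule S_power[OF aS])
    show "a ^ i \<notin> mx Rinf" by (rule mx_prime_power[OF Rinf S_D[OF aS Rinf w_mx] a_not])
    fix R assume R: "R \<in> V" "w \<in> mx R" "R \<noteq> Rinf"
    have aR: "a \<in> R" by (rule S_D[OF aS R(1,2)])
    have "a ^ (d - 1) * a \<in> mx R" by (rule mx_mult[OF R(1) a_mx[OF R] V_power[OF R(1) aR]])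
    then have ad: "a ^ d \<in> mx R" using z(1) by (cases d) (simp_all add: mult.commute)
    have "1 - a ^ d \<notin> mx R"
    proof
      assume "1 - a ^ d \<in> mx R"
      from mx_add[OF R(1) this ad] show False using mx_one[OF R(1)] by simp
    qed
    moreover have "1 - a ^ d \<in> R" by (intro V_diff[OF R(1)] V_one[OF R(1)] V_power[OF R(1) aR])
    ultimately have u: "1 - a ^ d \<noteq> 0" "inverse (1 - a ^ d) \<in> R" using unit_inverse by blast+
    have "a ^ i / w = z * inverse (1 - a ^ d)"
      using z(3) u(1) w_nz by (simp add: field_simps)
    then show "a ^ i / w \<in> R" using V_mult[OF R(1) S_D[OF z(2) R(1,2)] u(2)] by simp
  qed
qed

text \<open>A maximal independent family over F(w) is multiplied by denominators in F[1/w], after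
  which its poles lie only at zeros of \<open>w\<close>; the power w^c clears these poles.\<close>

lemma integral_family:
  obtains u c where "indep w field_degree u" "\<And>i R. i < field_degree \<Longrightarrow> R \<in> V \<Longrightarrow> inverse w \<in> R \<Longrightarrow> u i \<in> R"
    "\<And>i. i < field_degree \<Longrightarrow> w ^ c * u i \<in> S"
proof -
  let ?y = "inverse w"
  have y: "?y \<notin> F" using inverse_F[of ?y] w_not_F by auto
  obtain u0 where u0: "indep w field_degree u0" using field_degree_attained by blast
  have "\<exists>d. d \<in> polys \<and> d \<noteq> 0 \<and> (\<forall>R\<in>V. ?y \<in> R \<longrightarrow> poly d ?y * z \<in> R)" for z
    using clear_denominator[OF y, where z = z] by metis
  then have "\<exists>e. \<forall>i. e i \<in> polys \<and> e i \<noteq> 0 \<and> (\<forall>R\<in>V. ?y \<in> R \<longrightarrow> poly (e i) ?y * u0 i \<in> R)"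
    by (intro choice allI)
  then obtain e where e: "\<And>i. e i \<in> polys" "\<And>i. e i \<noteq> 0"
    "\<And>i R. R \<in> V \<Longrightarrow> ?y \<in> R \<Longrightarrow> poly (e i) ?y * u0 i \<in> R" by blast
  define u where "u = (\<lambda>i. poly (e i) ?y * u0 i)"
  define M where "M = (\<Sum>i<field_degree. Polynomial.degree (e i))"
  \<comment> \<open>Since e_i(1/w) is not a polynomial in \<open>w\<close>, its coefficients are
    reversed: w^M e_i(1/w) is \<open>poly (h i) w\<close>, with M at least every degree.
    Independence over F[w] then passes from \<open>u0\<close> to \<open>u\<close>.\<close>
  define h where "h = (\<lambda>i. Polynomial.monom 1 (M - Polynomial.degree (e i)) * reflect_poly (e i))"
  have h: "h i \<in> polys" "h i \<noteq> 0" for i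
    unfolding h_def using e by (auto intro: mult_polys monom_polys reflect_polys simp: monom_eq_0_iff)
  have hw: "poly (h i) w = w ^ M * poly (e i) ?y" if "i < field_degree" for i
  proof -
    have "Polynomial.degree (e i) \<le> M" unfolding M_def using that by (intro member_le_sum) auto
    then have "w ^ M = w ^ (M - Polynomial.degree (e i)) * w ^ Polynomial.degree (e i)"
      by (simp flip: power_add)
    then show ?thesis
      by (simp add: h_def poly_monom poly_reflect_poly_nz[OF w_nz] mult.assoc)
  qed
  have indep: "indep w field_degree u"
    unfolding indep_def
  proof (intro allI impI)
    fix p i
    assume p: "\<forall>i<field_degree. p i \<in> polys" and rel: "(\<Sum>i<field_degree. poly (p i) w * u i) = 0" and i: "i < field_degree"
    have "(\<Sum>i<field_degree. poly (p i * h i) w * u0 i) = w ^ M * (\<Sum>i<field_degree. poly (p i) w * u i)"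
      unfolding sum_distrib_left by (rule sum.cong) (simp_all add: hw u_def)
    then have "(\<Sum>i<field_degree. poly (p i * h i) w * u0 i) = 0" unfolding rel by simp
    moreover have "p i * h i \<in> polys" if "i < field_degree" for i using p h that by (simp add: mult_polys)
    ultimately have "p i * h i = 0" using indepD[OF u0, of "\<lambda>i. p i * h i"] i by blast
    then show "p i = 0" using h(2) by simp
  qed
  have "\<exists>c. \<forall>i. w ^ c i * u i \<in> S" using power_mult_S by (intro choice allI)
  then obtain c where c: "\<And>i. w ^ c i * u i \<in> S" by blast
  show thesis
  proof (rule that[OF indep])
    show "u i \<in> R" if "i < field_degree" "R \<in> V" "?y \<in> R" for i R
      unfolding u_def using e(3) that by blast
    show "w ^ (\<Sum>i<field_degree. c i) * u i \<in> S" if "i < field_degree" for i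
    proof -
      have "c i \<le> (\<Sum>i<field_degree. c i)" using that by (intro member_le_sum) auto
      then have "w ^ (\<Sum>i<field_degree. c i) = w ^ ((\<Sum>i<field_degree. c i) - c i) * w ^ c i"
        by (simp flip: power_add)
      then have "w ^ (\<Sum>i<field_degree. c i) * u i = w ^ ((\<Sum>i<field_degree. c i) - c i) * (w ^ c i * u i)"
        by (simp only: mult.assoc)
      then show ?thesis
        using S_mult[OF S_power[OF S_w] c, of "(\<Sum>i<field_degree. c i) - c i" i] by (simp only:)
    qed
  qed
qed

text \<open>
  Modulo \<open>w\<^sup>m\<close> there are at most \<open>|F|\<^bsup>m n\<^esup>\<close> classes in \<open>S\<close>, where \<open>n = field_degree\<close> is \<open>[K : F(w)]\<close>. The
  functions \<open>f\<close> below have poles only above \<open>w\<close>, with \<open>w\<^sup>m f\<close> in \<open>S\<close>, and form a space of dimension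
  \<open>m n - O(1)\<close> over \<open>F\<close>. Adding the \<open>|F|\<^sup>m\<close> elements \<open>a\<^sup>m e(w)\<close>, with \<open>a\<close> divisible by \<open>w\<close> at all places above
  \<open>w\<close> but \<open>Rinf\<close>, gives more than \<open>|F|\<close> sums in one class. Differences of the corresponding \<open>f\<close> are
  integral outside \<open>Rinf\<close>.
\<close>

lemma nonconstant_element: "\<exists>t. t \<notin> F \<and> (\<forall>R\<in>V. R \<noteq> Rinf \<longrightarrow> t \<in> R)"
proof -
  obtain u c where u: "indep w field_degree u" and uR: "\<And>i R. i < field_degree \<Longrightarrow> R \<in> V \<Longrightarrow> inverse w \<in> R \<Longrightarrow> u i \<in> R"
    and uS: "\<And>i. i < field_degree \<Longrightarrow> w ^ c * u i \<in> S"
    using integral_family by metis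
  obtain a where a: "a \<in> S" "a \<notin> mx Rinf"
    and aR: "\<And>R. R \<in> V \<Longrightarrow> w \<in> mx R \<Longrightarrow> R \<noteq> Rinf \<Longrightarrow> a / w \<in> R"
    using separating_element by metis
  \<comment> \<open>With n = \<open>field_degree\<close> and M = m - c, the count needs n (M + 1) +
    m > n m + 1, that is, m + n > n c + 1. The shift by c makes w^m f(q) a combination of the w^c
    u_i, which lie in \<open>S\<close>.\<close>
  define m where "m = field_degree * c + c + 2"
  define M where "M = m - c"
  have mM: "m = c + M" by (simp add: M_def m_def)
  obtain T and r :: "'k \<Rightarrow> nat \<Rightarrow> 'k poly" where T: "finite T" "card T \<le> card F ^ (field_degree * m)" "r ` S \<subseteq> T"
    and r: "\<And>s s'. s \<in> S \<Longrightarrow> s' \<in> S \<Longrightarrow> r s = r s' \<Longrightarrow> \<exists>z\<in>S. s - s' = w ^ m * z"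
    using residues[of m] by metis
  let ?Q = "PiE {..<field_degree} (\<lambda>_. polys_below (Suc M))"
  let ?I = "?Q \<times> polys_below m"
  define f where "f = (\<lambda>q. \<Sum>i<field_degree. poly (q i) w / w ^ M * u i)"
  define g where "g = (\<lambda>(q, e). w ^ m * f q + a ^ m * poly e w)"
  have Qi: "q i \<in> polys" "Polynomial.degree (q i) \<le> M" if "q \<in> ?Q" "i < field_degree" for q i
    using PiE_mem[OF that(1), of i] that(2) by (simp_all add: polys_below_Suc_iff)
  have wf: "w ^ m * f q = (\<Sum>i<field_degree. poly (q i) w * (w ^ c * u i))" for q
    unfolding f_def sum_distrib_left mM power_add
    by (rule sum.cong) (simp_all add: w_nz)
  have gS: "g qe \<in> S" if qe: "qe \<in> ?I" for qe
  proof -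
    obtain q e where q: "qe = (q, e)" "q \<in> ?Q" "e \<in> polys_below m" using qe by blast
    have "w ^ m * f q \<in> S"
      unfolding wf by (rule S_sum) (simp add: S_mult[OF S_poly[OF Qi(1)[OF q(2)]] uS])
    moreover have "a ^ m * poly e w \<in> S"
      by (intro S_mult S_power a(1) S_poly polys_below_polys[OF q(3)])
    ultimately show ?thesis
      unfolding g_def q(1) prod.case by (rule S_add)
  qed
  \<comment> \<open>The additional factor |F| produces a fiber too large for all differences to be
    constants.\<close>
  have "card F * card T < card ?I"
  proof -
    have "card F * card T \<le> card F ^ Suc (field_degree * m)" using T(2) by simp
    also have "Suc (field_degree * m) < field_degree * Suc M + m"
      unfolding mM by (simp add: m_def M_def algebra_simps)
    then have "card F ^ Suc (field_degree * m) < card F ^ (field_degree * Suc M + m)"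
      using card_F by (intro power_strict_increasing) simp_all
    also have "card F ^ (field_degree * Suc M + m) = card ?I"
      by (simp add: card_cartesian_product card_PiE_polys_below card_polys_below power_add)
    finally show ?thesis .
  qed
  moreover have "(\<lambda>qe. r (g qe)) ` ?I \<subseteq> T" using T(3) gS by blast
  moreover have "finite ?I" using finite_PiE_polys_below finite_polys_below by simp
  ultimately obtain y where y: "card F < card {qe \<in> ?I. r (g qe) = y}"
    using pigeonhole_fiber[OF T(1), of "\<lambda>qe. r (g qe)" ?I "card F"] by blast
  define H where "H = {qe \<in> ?I. r (g qe) = y}"
  have cardH: "card F < card H" using y by (simp add: H_def)
  then have finH: "finite H" by (simp add: card_ge_0_finite)
  have "H \<noteq> {}" using cardH by auto
  then obtain q0 e0 where q0: "(q0, e0) \<in> H" by (metis ex_in_conv surj_pair)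
  have H: "q \<in> ?Q" "e \<in> polys_below m" if "(q, e) \<in> H" for q e
    using that by (auto simp: H_def)
  have cong: "\<exists>z\<in>S. w ^ m * (f q - f q') + a ^ m * (poly e w - poly e' w) = w ^ m * z"
    if qe: "(q, e) \<in> H" "(q', e') \<in> H" for q e q' e'
  proof -
    have 1: "(q, e) \<in> ?I" "(q', e') \<in> ?I" "r (g (q, e)) = r (g (q', e'))"
      using qe by (simp_all add: H_def)
    have "g (q, e) - g (q', e') = w ^ m * (f q - f q') + a ^ m * (poly e w - poly e' w)"
      by (simp add: g_def algebra_simps)
    then show ?thesis using r[OF gS[OF 1(1)] gS[OF 1(2)] 1(3)] by simp
  qed
  \<comment> \<open>At \<open>Rinf\<close> the element a is a unit, while a nonzero polynomial in
    \<open>w\<close> of degree below m is w^j times a unit with j < m. So a^m times it is not in w^m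
    S.\<close>
  have e_eq: "e = e'" if qe: "(q, e) \<in> H" "(q', e') \<in> H" and feq: "f q = f q'" for q e q' e'
  proof (rule ccontr)
    assume "e \<noteq> e'"
    define d where "d = e - e'"
    have d: "d \<in> polys_below m" "d \<noteq> 0" unfolding d_def
      using diff_polys_below[OF H(2)[OF qe(1)] H(2)[OF qe(2)]] \<open>e \<noteq> e'\<close> by simp_all
    obtain z where z: "z \<in> S" "a ^ m * poly d w = w ^ m * z"
      using cong[OF qe] by (auto simp: feq d_def)
    obtain j p where p: "p \<in> polys" "Polynomial.coeff p 0 \<noteq> 0" "d = Polynomial.monom 1 j * p"
      using split_X_power[OF polys_below_polys[OF d(1)] d(2)] by blast
    have "Polynomial.coeff d j \<noteq> 0" using p(2,3) by (simp add: coeff_monom_mult)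
    then have "j < m" using d(1) by (auto simp: polys_below_def not_le[symmetric])
    then have "w ^ m = w ^ j * w ^ (m - j)" by (simp flip: power_add)
    then have "w ^ j * (a ^ m * poly p w) = w ^ j * (w ^ (m - j) * z)"
      using z(2) by (simp add: p(3) poly_monom mult_ac)
    then have eq: "a ^ m * poly p w = w ^ (m - j) * z" using w_nz by simp
    have "(w ^ (m - j - 1) * z) * w \<in> mx Rinf"
      by (intro mx_mult[OF Rinf w_mx] S_D[OF _ Rinf w_mx] S_mult S_power S_w z(1))
    moreover have "w ^ (m - j) = w ^ (m - j - 1) * w" using \<open>j < m\<close> by (cases "m - j") simp_all
    ultimately have "a ^ m * poly p w \<in> mx Rinf" unfolding eq by (simp add: mult_ac)
    then have "poly p w \<in> mx Rinf"
      using mx_prime[OF Rinf _ _ _ mx_prime_power[OF Rinf _ a(2)]] S_D[OF _ Rinf w_mx] a(1) S_power S_poly[OF p(1)]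
      by blast
    then show False using poly_unit[OF Rinf w_mx p(1,2)] by blast
  qed
  have q_eq: "q = q'" if q: "q \<in> ?Q" "q' \<in> ?Q" "f q = f q'" for q q'
  proof -
    have "(\<Sum>i<field_degree. poly (q i - q' i) w * u i) = w ^ M * (f q - f q')"
      by (simp add: f_def sum_distrib_left right_diff_distrib left_diff_distrib sum_subtractf w_nz)
    then have rel: "(\<Sum>i<field_degree. poly (q i - q' i) w * u i) = 0" using q(3) by simp
    have dq: "q i - q' i \<in> polys" if "i < field_degree" for i
      using Qi(1)[OF q(1) that] Qi(1)[OF q(2) that] by (rule diff_polys)
    have "q i = q' i" if "i < field_degree" for i
      using indepD[OF u dq rel that] by simp
    then show ?thesis by (intro PiE_ext[OF q(1,2)]) simp
  qed
  let ?D = "(\<lambda>(q, e). f q - f q0) ` H"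
  have "inj_on (\<lambda>(q, e). f q - f q0) H"
  proof (rule inj_onI)
    fix h h' assume h: "h \<in> H" "h' \<in> H" "(\<lambda>(q, e). f q - f q0) h = (\<lambda>(q, e). f q - f q0) h'"
    obtain q e q' e' where qe: "h = (q, e)" "h' = (q', e')" by (metis surj_pair)
    have "f q = f q'" using h(3) by (simp add: qe)
    then show "h = h'" using e_eq[of q e q' e'] q_eq[of q q'] H(1) h(1,2) by (simp add: qe)
  qed
  then have "card F < card ?D" using cardH by (simp add: card_image)
  then have "\<not> ?D \<subseteq> F" using card_mono[OF finite_F, of ?D] by auto
  then obtain q e where qe: "(q, e) \<in> H" "f q - f q0 \<notin> F" by auto
  have "f q - f q0 \<in> R" if R: "R \<in> V" "R \<noteq> Rinf" for R
  proof (cases "w \<in> mx R")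
    case True
    obtain z where z: "z \<in> S" "w ^ m * (f q - f q0) + a ^ m * (poly e w - poly e0 w) = w ^ m * z"
      using cong[OF qe(1) q0] by blast
    have "w ^ m * (f q - f q0) = w ^ m * (z - (a / w) ^ m * (poly e w - poly e0 w))"
      using z(2) w_nz by (simp add: power_divide right_diff_distrib eq_diff_eq)
    then have "f q - f q0 = z - (a / w) ^ m * (poly e w - poly e0 w)" using w_nz by simp
    also have "\<dots> \<in> R"
      using aR[OF R(1) True R(2)] S_D[OF z(1) R(1) True] V_poly[OF R(1) _ mx_sub[OF True]]
        polys_below_polys[OF H(2)[OF qe(1)]] polys_below_polys[OF H(2)[OF q0]]
      by (intro V_diff[OF R(1)] V_mult[OF R(1)] V_power[OF R(1)]) simp_all
    finally show ?thesis .
  next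
    case False
    \<comment> \<open>Here the u_i are integral, and q_i(w) / w^M is a polynomial in 1/w because q_i
      has degree at most M.\<close>
    then have y: "inverse w \<in> R" using V_total[OF R(1) w_nz] by (auto simp: mx_def w_nz)
    have "f q \<in> R" if q: "q \<in> ?Q" for q
      unfolding f_def
    proof (intro V_sum[OF R(1)] V_mult[OF R(1)])
      fix i assume "i \<in> {..<field_degree}"
      then have i: "i < field_degree" by simp
      show "u i \<in> R" by (rule uR[OF i R(1) y])
      have "poly (q i) w / w ^ M = (\<Sum>j\<le>Polynomial.degree (q i). Polynomial.coeff (q i) j * inverse w ^ (M - j))"
        unfolding poly_altdef sum_divide_distrib
      proof (rule sum.cong[OF refl])
        fix j assume "j \<in> {..Polynomial.degree (q i)}"
        then have "j \<le> M" using Qi(2)[OF q i] by simp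
        then have "w ^ M = w ^ j * w ^ (M - j)" by (simp flip: power_add)
        then show "Polynomial.coeff (q i) j * w ^ j / w ^ M = Polynomial.coeff (q i) j * inverse w ^ (M - j)"
          using w_nz by (simp add: power_inverse field_simps)
      qed
      also have "\<dots> \<in> R"
        by (intro V_sum[OF R(1)] V_mult[OF R(1) V_F[OF R(1) coeff_F[OF Qi(1)[OF q i]]] V_power[OF R(1) y]])
      finally show "poly (q i) w / w ^ M \<in> R" .
    qed
    then show ?thesis using H(1)[OF qe(1)] H(1)[OF q0] V_diff[OF R(1)] by blast
  qed
  then show ?thesis using qe(2) by blast
qed

end

section \<open>The ring of integers away from a place\<close>

lemma KK_simps [simp]:
  "carrier KK = UNIV" "a \<otimes>\<^bsub>KK\<^esub> b = a * b" "\<one>\<^bsub>KK\<^esub> = 1" "\<zero>\<^bsub>KK\<^esub> = 0" "a \<oplus>\<^bsub>KK\<^esub> b = a + b"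
  by (simp_all add: ring_of_type_algebra_def)

lemma field_KK: "field KK"
  by (rule field_from_type_algebra)

lemma ring_KK: "ring KK"
  by (rule ring_from_type_algebra)

lemma a_inv_KK [simp]: "\<ominus>\<^bsub>KK\<^esub> a = - a" for a :: "'k::field"
proof -
  interpret K: field "KK :: 'k ring" by (rule field_KK)
  show ?thesis using K.minus_equality[of "- a" a] by simp
qed

lemma m_inv_KK: "a \<noteq> 0 \<Longrightarrow> inv\<^bsub>KK\<^esub> a = inverse a" for a :: "'k::field"
proof -
  interpret K: field "KK :: 'k ring" by (rule field_KK)
  show "a \<noteq> 0 \<Longrightarrow> inv\<^bsub>KK\<^esub> a = inverse a" using K.comm_inv_char[of a "inverse a"] by simp
qed

lemma pow_KK [simp]: "a [^]\<^bsub>KK\<^esub> (n::nat) = a ^ n" for a :: "'k::field"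
proof -
  interpret K: field "KK :: 'k ring" by (rule field_KK)
  show ?thesis by (induction n) (simp_all add: mult.commute)
qed

lemma subring_KK:
  fixes R :: "'k::field set"
  assumes "subring R KK"
  shows "0 \<in> R" "1 \<in> R" "a \<in> R \<Longrightarrow> - a \<in> R" "a \<in> R \<Longrightarrow> b \<in> R \<Longrightarrow> a * b \<in> R" "a \<in> R \<Longrightarrow> b \<in> R \<Longrightarrow> a + b \<in> R"
  using subringE[OF assms] by simp_all

lemma subfield_KK:
  assumes "subfield F KK" "finite F"
  shows "finite_subfield F"
proof
  note sub = subring_KK[OF subfieldE(1)[OF assms(1)]]
  show "inverse a \<in> F" if "a \<in> F" for a
  proof (cases "a = 0")
    case False
    then show ?thesis
      using ring.subfield_m_inv(1)[OF ring_KK assms(1), of a] that by (simp add: m_inv_KK)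
  qed (simp add: sub)
qed (use assms(2) subring_KK[OF subfieldE(1)[OF assms(1)]] in simp_all)

lemma eval_snoc: "ring.eval KK (xs @ [a]) z = ring.eval KK xs z * z + a" for a :: "'k::field"
proof -
  interpret K: field "KK :: 'k ring" by (rule field_KK)
  show ?thesis
    by (induction xs) (simp_all add: algebra_simps)
qed

text \<open>List polynomials begin with the leading coefficient, \<open>coeffs\<close> with the
  constant one.\<close>

lemma eval_rev_coeffs: "ring.eval KK (rev (coeffs p)) z = poly p z" for z :: "'k::field"
proof -
  interpret K: field "KK :: 'k ring" by (rule field_KK)
  show ?thesis
    by (induction p) (auto simp: coeffs_pCons_eq_cCons cCons_def eval_snoc mult.commute)
qed

lemma dimension_combination:
  fixes L :: "'k::field set"
  assumes "ring.dimension KK n L E"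
  shows "\<exists>v. \<forall>z\<in>E. \<exists>c. (\<forall>i<n. c i \<in> L) \<and> z = (\<Sum>i<n. c i * v i)"
proof -
  interpret K: field "KK :: 'k ring" by (rule field_KK)
  from assms show ?thesis
  proof (induction rule: K.dimension.induct)
    case (Suc_dim u E n L)
    then obtain v where v: "\<forall>z\<in>E. \<exists>c. (\<forall>i<n. c i \<in> L) \<and> z = (\<Sum>i<n. c i * v i)" by blast
    let ?v = "v(n := u)"
    have "\<exists>c. (\<forall>i<Suc n. c i \<in> L) \<and> z = (\<Sum>i<Suc n. c i * ?v i)" if z: "z \<in> K.line_extension L u E" for z
    proof -
      obtain k e where k: "k \<in> L" "e \<in> E" "z = k * u + e"
        using z unfolding K.line_extension_def r_coset_def set_add_def set_mult_def by auto
      obtain c where c: "\<forall>i<n. c i \<in> L" "e = (\<Sum>i<n. c i * v i)" using v k(2) by blast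
      have "(\<Sum>i<n. (c(n := k)) i * ?v i) = (\<Sum>i<n. c i * v i)" by (rule sum.cong) simp_all
      then have "z = (\<Sum>i<Suc n. (c(n := k)) i * ?v i)" by (simp add: k(3) c(2) add.commute)
      moreover have "\<forall>i<Suc n. (c(n := k)) i \<in> L" using c(1) k(1) by (simp add: less_Suc_eq)
      ultimately show ?thesis by blast
    qed
    then show ?case by blast
  qed simp
qed

context finite_subfield
begin

lemma transcendental_imp_transc:
  assumes "ring.transcendental KK F z"
  shows "transc z"
  unfolding transc_def
proof (intro ballI impI)
  interpret K: field "KK :: 'k ring" by (rule field_KK)
  fix p assume p: "p \<in> polys" "poly p z = 0"
  show "p = 0"
  proof (rule ccontr)
    assume nz: "p \<noteq> 0"
    have ne: "coeffs p \<noteq> []" using nz by simp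
    have "set (coeffs p) \<subseteq> F" using coeff_F[OF p(1)] by (auto simp: coeffs_def)
    moreover have "hd (rev (coeffs p)) \<noteq> 0"
      using nz ne by (simp add: hd_rev last_coeffs_eq_coeff_degree)
    ultimately have "rev (coeffs p) \<in> carrier (F[X]\<^bsub>KK\<^esub>)"
      by (simp add: univ_poly_def polynomial_def)
    \<comment> \<open>The empty list is the zero polynomial; injectivity of evaluation is applied to
      it and to the reversed coefficients.\<close>
    moreover have "[] \<in> carrier (F[X]\<^bsub>KK\<^esub>)"
      by (simp add: univ_poly_def polynomial_def)
    moreover have "K.eval (rev (coeffs p)) z = K.eval [] z"
      by (simp add: eval_rev_coeffs p(2))
    ultimately have "rev (coeffs p) = []"
      using assms unfolding K.transcendental_def inj_on_def by blast
    then show False using ne by simp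
  qed
qed

lemma generate_field_fractions:
  assumes "transc x" "h \<in> generate_field KK (insert x F)"
  shows "\<exists>a\<in>polys. \<exists>b\<in>polys. b \<noteq> 0 \<and> h = poly a x / poly b x"
  using assms(2)
proof (induction rule: generate_field.induct)
  case one
  show ?case by (intro bexI[of _ 1]) (simp_all add: one_polys)
next
  case (incl h)
  show ?case
  proof (cases "h = x")
    case True
    then show ?thesis
      by (intro bexI[of _ "[:0, 1:]"] bexI[of _ 1]) (simp_all add: pCons_polys zero_F one_F zero_polys one_polys)
  next
    case False
    then show ?thesis
      using incl by (intro bexI[of _ "[:h:]"] bexI[of _ 1]) (simp_all add: pCons_polys zero_polys one_polys)
  qed
next
  case (a_inv h)
  then obtain a b where "a \<in> polys" "b \<in> polys" "b \<noteq> 0" "h = poly a x / poly b x" by blast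
  then show ?case by (intro bexI[of _ "- a"] bexI[of _ b]) (simp_all add: uminus_polys)
next
  case (m_inv h)
  then obtain a b where ab: "a \<in> polys" "b \<in> polys" "b \<noteq> 0" "h = poly a x / poly b x" by blast
  have "h \<noteq> 0" using m_inv.hyps by simp
  then have "a \<noteq> 0" "inv\<^bsub>KK\<^esub> h = inverse h" using ab by (auto simp: m_inv_KK)
  then show ?case using ab by (intro bexI[of _ b] bexI[of _ a]) simp_all
next
  case (eng_add h1 h2)
  then obtain a b where ab: "a \<in> polys" "b \<in> polys" "b \<noteq> 0" "h1 = poly a x / poly b x" by blast
  obtain c d where cd: "c \<in> polys" "d \<in> polys" "d \<noteq> 0" "h2 = poly c x / poly d x" using eng_add.IH(2) by blast
  have "poly b x \<noteq> 0" "poly d x \<noteq> 0" using ab cd transcD[OF assms(1)] by blast+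
  then have "h1 \<oplus>\<^bsub>KK\<^esub> h2 = poly (a * d + c * b) x / poly (b * d) x"
    by (simp add: ab(4) cd(4) add_frac_eq)
  moreover have "b * d \<noteq> 0" using ab cd by simp
  ultimately show ?case using ab cd by (intro bexI[of _ "a * d + c * b"] bexI[of _ "b * d"]) (simp_all add: add_polys mult_polys)
next
  case (eng_mult h1 h2)
  then obtain a b where ab: "a \<in> polys" "b \<in> polys" "b \<noteq> 0" "h1 = poly a x / poly b x" by blast
  obtain c d where cd: "c \<in> polys" "d \<in> polys" "d \<noteq> 0" "h2 = poly c x / poly d x" using eng_mult.IH(2) by blast
  have "h1 \<otimes>\<^bsub>KK\<^esub> h2 = poly (a * c) x / poly (b * d) x" by (simp add: ab(4) cd(4))
  moreover have "b * d \<noteq> 0" using ab cd by simp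
  ultimately show ?case using ab cd by (intro bexI[of _ "a * c"] bexI[of _ "b * d"]) (simp_all add: mult_polys)
qed

end

lemma function_fieldI:
  fixes F :: "'k::field set"
  assumes "finite F" "function_field_with_constants F"
  shows "\<exists>x N v. function_field F (valuation_rings F) x N v"
proof -
  have F: "subfield F KK" and alg: "{x. ring.algebraic KK F x} = F"
    using assms(2) by (simp_all add: function_field_with_constants_def)
  obtain x where x: "ring.transcendental KK F x"
    and fin: "ring.finite_dimension KK (generate_field KK (insert x F)) UNIV"
    using assms(2) unfolding function_field_with_constants_def by blast
  interpret finite_subfield F using F assms(1) by (rule subfield_KK)
  have tx: "transc x" using x by (rule transcendental_imp_transc)
  obtain N where "ring.dimension KK N (generate_field KK (insert x F)) UNIV"
    using fin unfolding ring.finite_dimension_def[OF ring_KK] by blast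
  from dimension_combination[OF this] obtain v
    where v: "\<And>z. \<exists>c. (\<forall>i<N. c i \<in> generate_field KK (insert x F)) \<and> z = (\<Sum>i<N. c i * v i)" by auto
  have gen: "\<exists>d c. d \<in> polys \<and> d \<noteq> 0 \<and> (\<forall>i<N. c i \<in> polys) \<and> poly d x * z = (\<Sum>i<N. poly (c i) x * v i)" for z
  proof -
    obtain c where c: "\<And>i. i < N \<Longrightarrow> c i \<in> generate_field KK (insert x F)" "z = (\<Sum>i<N. c i * v i)"
      using v[of z] by blast
    have "\<forall>i\<in>{..<N}. \<exists>ab. fst ab \<in> polys \<and> snd ab \<in> polys \<and> snd ab \<noteq> 0 \<and> c i = poly (fst ab) x / poly (snd ab) x"
      using generate_field_fractions[OF tx c(1)] by fastforce
    from bchoice[OF this] obtain ab where ab: "\<And>i. i < N \<Longrightarrow> fst (ab i) \<in> polys" "\<And>i. i < N \<Longrightarrow> snd (ab i) \<in> polys"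
      "\<And>i. i < N \<Longrightarrow> snd (ab i) \<noteq> 0" "\<And>i. i < N \<Longrightarrow> c i = poly (fst (ab i)) x / poly (snd (ab i)) x" by auto
    define d where "d = (\<Prod>i<N. snd (ab i))"
    define e where "e = (\<lambda>i. prod (\<lambda>i. snd (ab i)) ({..<N} - {i}))"
    have dp: "d \<in> polys" "d \<noteq> 0" unfolding d_def using ab by (auto intro: prod_polys)
    have ep: "fst (ab i) * e i \<in> polys" if "i < N" for i
      unfolding e_def using ab that by (auto intro!: mult_polys prod_polys)
    have "poly d x * (c i * v i) = poly (fst (ab i) * e i) x * v i" if "i < N" for i
    proof -
      have "d = snd (ab i) * e i" unfolding d_def e_def using that by (intro prod.remove) auto
      moreover have "poly (snd (ab i)) x \<noteq> 0" using transcD[OF tx ab(2,3)[OF that]] .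
      ultimately show ?thesis by (simp add: ab(4)[OF that])
    qed
    then have "poly d x * z = (\<Sum>i<N. poly (fst (ab i) * e i) x * v i)"
      unfolding c(2) sum_distrib_left by (intro sum.cong) simp_all
    then show ?thesis using dp ep by (intro exI[of _ d] exI[of _ "\<lambda>i. fst (ab i) * e i"]) simp
  qed
  have "function_field F (valuation_rings F) x N v"
  proof unfold_locales
    \<comment> \<open>Here F enters as the full constant field: an element outside it is not
      algebraic.\<close>
    show "transc t" if "t \<notin> F" for t
      using that alg by (intro transcendental_imp_transc) blast
  qed (use tx gen in \<open>auto simp: valuation_rings_def subring_KK\<close>)
  then show ?thesis by blast
qed

section \<open>Places, valuation rings and the fraction field of the ring of integers\<close>

lemma (in function_field) maximalideal_mx:
  assumes R: "R \<in> V" and sub: "subring R KK" and P: "maximalideal P (KK\<lparr>carrier := R\<rparr>)"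
  shows "P = mx R"
proof -
  let ?R = "KK\<lparr>carrier := R\<rparr>"
  interpret P: maximalideal P ?R by (rule P)
  have Psub: "P \<subseteq> R" using P.a_subset by simp
  have P_mult: "r * a \<in> P" if "a \<in> P" "r \<in> R" for r a
    using P.I_l_closed[of a r] that by simp
  have P_mx: "P \<subseteq> mx R"
  proof
    fix z assume z: "z \<in> P"
    have "inverse z \<notin> R" if nz: "z \<noteq> 0"
    proof
      assume "inverse z \<in> R"
      then have "1 \<in> P" using P_mult[OF z, of "inverse z"] nz by simp
      then have "R \<subseteq> P" using P_mult[of 1] by auto
      then show False using P.I_notcarr Psub by simp
    qed
    then show "z \<in> mx R" using z Psub by (auto simp: mx_def)
  qed
  have ringR: "ring ?R" using ring.subring_is_ring[OF ring_KK sub] .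
  \<comment> \<open>The maximal ideal P contains no units, so it lies in \<open>mx R\<close>; since
    the latter is a proper ideal, maximality forces equality.\<close>
  have "ideal (mx R) ?R"
  proof (rule idealI[OF ringR])
    show "subgroup (mx R) (add_monoid ?R)"
    proof (rule P.add.subgroupI)
      show "mx R \<subseteq> carrier ?R" by (auto simp: mx_def)
      have "0 \<in> mx R" using V_zero[OF R] by (simp add: mx_def)
      then show "mx R \<noteq> {}" by blast
      fix a assume a: "a \<in> mx R"
      have "\<ominus>\<^bsub>?R\<^esub> a = - a"
        using P.minus_equality[of "- a" a] a V_uminus[OF R mx_sub[OF a]] mx_sub[OF a] by simp
      then show "\<ominus>\<^bsub>?R\<^esub> a \<in> mx R" using mx_uminus[OF R a] by simp
      fix b assume b: "b \<in> mx R"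
      show "a \<oplus>\<^bsub>?R\<^esub> b \<in> mx R" using mx_add[OF R a b] by simp
    qed
    fix a r assume a: "a \<in> mx R" and r: "r \<in> carrier ?R"
    show "r \<otimes>\<^bsub>?R\<^esub> a \<in> mx R" "a \<otimes>\<^bsub>?R\<^esub> r \<in> mx R"
      using mx_mult[OF R a, of r] r by (simp_all add: mult.commute)
  qed
  then have "mx R = P \<or> mx R = R"
    using P.I_maximal[of "mx R"] P_mx mx_sub[of _ R] by auto
  moreover have "mx R \<noteq> R" using mx_one[OF R] V_one[OF R] by blast
  ultimately show ?thesis by blast
qed

text \<open>An element z is outside a valuation ring exactly when it is nonzero and 1/z lies in the
  maximal ideal.\<close>

lemma (in function_field) mx_inj:
  assumes "R \<in> V" "R' \<in> V" "mx R = mx R'"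
  shows "R = R'"
proof -
  have "Q \<subseteq> Q'" if Q: "Q \<in> V" "Q' \<in> V" "mx Q = mx Q'" for Q Q'
  proof
    fix z assume z: "z \<in> Q"
    show "z \<in> Q'"
    proof (rule ccontr)
      assume not: "z \<notin> Q'"
      then have nz: "z \<noteq> 0" using V_zero[OF Q(2)] by blast
      then have "inverse z \<in> Q'" using V_total[OF Q(2) nz] not by blast
      then have "inverse z \<in> mx Q'" using not by (simp add: mx_def)
      then have "inverse z \<in> mx Q" using Q(3) by simp
      then show False using z nz by (simp add: mx_def)
    qed
  qed
  then show ?thesis using assms by (metis equalityI)
qed

lemma (in finite_subfield) char_pos: "CHAR('k) > 0"
proof -
  have "of_nat n \<in> F" for n :: nat by (induction n) (simp_all add: zero_F one_F add_F)
  then have "range (of_nat :: nat \<Rightarrow> 'k) \<subseteq> F" by blast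
  then have "finite (range (of_nat :: nat \<Rightarrow> 'k))" using finite_F by (rule finite_subset)
  then have "\<not> inj (of_nat :: nat \<Rightarrow> 'k)" using finite_imageD infinite_UNIV_nat by blast
  then obtain i j :: nat where ij: "i < j" "(of_nat i :: 'k) = of_nat j"
    unfolding inj_on_def by (metis linorder_neqE_nat)
  then have "(of_nat (j - i) :: 'k) = 0" by (simp add: of_nat_diff)
  then show ?thesis unfolding CHAR_pos_iff using ij(1) by (intro exI[of _ "j - i"]) simp
qed

lemma cusp_ring_integers:
  fixes F Pinf :: "'k::field set"
  assumes "finite F" "function_field_with_constants F" "Pinf \<in> places F"
  shows "cusp_ring (integers_away_from F Pinf)"
proof -
  obtain x N v where "function_field F (valuation_rings F) x N v"
    using function_fieldI[OF assms(1,2)] by blast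
  then interpret function_field F "valuation_rings F" x N v .
  let ?V = "valuation_rings F"
  have V_sub: "subring R KK" "R \<noteq> UNIV" if "R \<in> ?V" for R
    using that by (auto simp: valuation_rings_def)
  have max_mx: "P = mx R" if "R \<in> ?V" "maximalideal P (KK\<lparr>carrier := R\<rparr>)" for P R
    using maximalideal_mx that V_sub by blast
  obtain Rinf where Rinf: "Rinf \<in> ?V" and Pinf: "maximalideal Pinf (KK\<lparr>carrier := Rinf\<rparr>)"
    using assms(3) unfolding places_def by blast
  obtain z where z: "z \<notin> Rinf" using V_sub(2)[OF Rinf] by blast
  define w where "w = inverse z"
  have "z \<noteq> 0" using z V_zero[OF Rinf] by blast
  then have w: "w \<noteq> 0" "w \<in> mx Rinf"
    using V_total[OF Rinf, of z] z by (simp_all add: w_def mx_def)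
  interpret function_field_place F ?V x N v Rinf w
    by unfold_locales (use Rinf w in simp_all)
  \<comment> \<open>The existential matches \<open>places\<close> by carrying a maximal ideal along
    with each ring; \<open>max_mx\<close> turns P \<noteq> \<open>Pinf\<close> into R \<noteq>
    \<open>Rinf\<close>.\<close>
  define W where "W = {R \<in> ?V. \<exists>P. maximalideal P (KK\<lparr>carrier := R\<rparr>) \<and> P \<noteq> Pinf}"
  have WV: "R \<in> ?V" and W_not: "R \<noteq> Rinf" if "R \<in> W" for R
    using that max_mx Pinf Rinf unfolding W_def by blast+
  define A where "A = integers_away_from F Pinf"
  have A: "a \<in> A \<longleftrightarrow> (\<forall>R\<in>W. a \<in> R)" for a
  proof
    assume a: "a \<in> A"
    show "\<forall>R\<in>W. a \<in> R"
    proof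
      fix R assume R: "R \<in> W"
      then obtain P where P: "maximalideal P (KK\<lparr>carrier := R\<rparr>)" "P \<noteq> Pinf" unfolding W_def by blast
      then have "P \<in> places F - {Pinf}" using WV[OF R] unfolding places_def by blast
      then obtain R' where R': "R' \<in> ?V" "maximalideal P (KK\<lparr>carrier := R'\<rparr>)" "a \<in> R'"
        using a unfolding A_def integers_away_from_def integral_at_def by blast
      have "mx R = mx R'" using max_mx[OF WV[OF R] P(1)] max_mx[OF R'(1,2)] by simp
      then show "a \<in> R" using mx_inj[OF WV[OF R] R'(1)] R'(3) by simp
    qed
  next
    assume a: "\<forall>R\<in>W. a \<in> R"
    show "a \<in> A"
      unfolding A_def integers_away_from_def integral_at_def
    proof (intro CollectI ballI)
      fix P assume P: "P \<in> places F - {Pinf}"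
      then obtain R where R: "R \<in> ?V" "maximalideal P (KK\<lparr>carrier := R\<rparr>)" unfolding places_def by blast
      then have "R \<in> W" using P unfolding W_def by blast
      then show "\<exists>R\<in>?V. maximalideal P (KK\<lparr>carrier := R\<rparr>) \<and> a \<in> R" using R a by blast
    qed
  qed
  obtain t where t_F: "t \<notin> F" and "\<forall>R\<in>?V. R \<noteq> Rinf \<longrightarrow> t \<in> R"
    using nonconstant_element by blast
  then have t: "t \<notin> F" "R \<in> W \<Longrightarrow> t \<in> R" for R
    using WV W_not by simp_all
  have "cusp_ring A"
  proof
    fix z
    \<comment> \<open>The denominator is d(t): since t is integral at every ring in
      \<open>W\<close>, so are d(t) and d(t) z.\<close>
    obtain d where d: "d \<in> polys" "d \<noteq> 0" "\<And>R. R \<in> ?V \<Longrightarrow> t \<in> R \<Longrightarrow> poly d t * z \<in> R"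
      using clear_denominator[OF t(1), where z = z] by blast
    have nz: "poly d t \<noteq> 0" using transcD[OF transc[OF t(1)] d(1,2)] .
    have "poly d t * z \<in> A" "poly d t \<in> A"
      unfolding A using d(3) V_poly[OF _ d(1)] t(2) WV by simp_all
    moreover have "z = poly d t * z / poly d t" using nz by simp
    ultimately show "\<exists>a\<in>A. \<exists>b\<in>A. b \<noteq> 0 \<and> z = a / b" using nz by blast
  qed (simp_all add: A WV V_zero V_one V_add V_mult V_uminus char_pos)
  then show ?thesis by (simp add: A_def)
qed

theorem theorem1p7:
  fixes F Pinf A :: "'k::field set"
  assumes "finite F"
    and "function_field_with_constants F"
    and "Pinf \<in> places F"
    and "A = integers_away_from F Pinf"
  shows "(\<forall>\<sigma>\<in>auto (GL2 A).
           (\<forall>s. \<exists>!s'. \<sigma> ` stab A s = stab A s') \<and>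
           (\<forall>s t s' t'. \<sigma> ` stab A s = stab A s' \<and> \<sigma> ` stab A t = stab A t' \<and>
               cusp A s = cusp A t \<longrightarrow> cusp A s' = cusp A t') \<and>
           (\<forall>s s'. \<sigma> ` stab A s = stab A s' \<longrightarrow> cusp_map A \<sigma> (cusp A s) = cusp A s') \<and>
           bij_betw (cusp_map A \<sigma>) (cusps A) (cusps A)) \<and>
         group_action (AutoGroup (GL2 A)) (cusps A) (cusp_map A)"
  unfolding assms(4) using cusp_ring_integers[OF assms(1-3)]
  by (rule cusp_ring.automorphisms_act_on_cusps)

end
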